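(* Let $X_o$ be a compact Hausdorff space, $\theta$ a homeomorphism of $X_o$ such that $(X_o,\theta)$ is uniquely ergodic with unique invariant regular Borel probability measure $\mu_o$, and let $f\in C(X_o;\mathbb{T})$. Let $\Phi_{\theta,f}(x,w):=(\theta(x),f(x)w)$ on $X_o\times\mathbb{T}$, acting on $C(X_o\times\mathbb{T})$ by $h\mapsto h\circ\Phi_{\theta,f}$. Then $(C(X_o\times\mathbb{T}),\Phi_{\theta,f})$ is uniquely ergodic with respect to the fixed-point subalgebra if and only if, for every $n\in\mathbb{Z}$, every $g\in L^\infty(X_o,\mu_o)$ satisfying $g(\theta(x))f(x)^n=g(x)$ for $\mu_o$-a.e. $x$ coincides $\mu_o$-a.e. with some $G\in C(X_o)$ satisfying $G(\theta(x))f(x)^n=G(x)$ for all $x\in X_o$.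
   Context: A system $(\mathfrak{B},\beta)$ ($\mathfrak{B}$ a unital $C^*$-algebra, $\beta$ an automorphism) is uniquely ergodic with respect to the fixed-point subalgebra if the Ces\`aro averages $\frac1n\sum_{k=0}^{n-1}\beta^k(x)$ converge in norm for every $x\in\mathfrak{B}$; equivalently, every state on $\mathfrak{B}^\beta=\{x\mid\beta(x)=x\}$ has a unique $\beta$-invariant state extension to $\mathfrak{B}$. $(X_o,\theta)$ uniquely ergodic means there is exactly one $\theta$-invariant regular Borel probability measure on $X_o$. *)

theory Defs
  imports "HOL-Probability.Probability"
begin

definition regular_borel_prob :: "'a::topological_space measure \<Rightarrow> bool" where
  "regular_borel_prob M \<longleftrightarrow>
     prob_space M \<and> sets M = sets borel \<and>
     (\<forall>B\<in>sets borel. emeasure M B = (INF U\<in>{U. open U \<and> B \<subseteq> U}. emeasure M U)) \<and>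
     (\<forall>U. open U \<longrightarrow> emeasure M U = (SUP K\<in>{K. compact K \<and> K \<subseteq> U}. emeasure M K))"

definition invariant_measure :: "('a \<Rightarrow> 'a) \<Rightarrow> 'a measure \<Rightarrow> bool" where
  "invariant_measure \<theta> M \<longleftrightarrow> (\<forall>B\<in>sets M. emeasure M (\<theta> -` B \<inter> space M) = emeasure M B)"

definition uniquely_ergodic_top :: "('a::topological_space \<Rightarrow> 'a) \<Rightarrow> bool" where
  "uniquely_ergodic_top \<theta> \<longleftrightarrow> (\<exists>!M. regular_borel_prob M \<and> invariant_measure \<theta> M)"

definition skew :: "('a \<Rightarrow> 'a) \<Rightarrow> ('a \<Rightarrow> complex) \<Rightarrow> 'a \<times> complex \<Rightarrow> 'a \<times> complex" where
  "skew \<theta> f = (\<lambda>(x, w). (\<theta> x, f x * w))"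

text \<open>Unique ergodicity w.r.t. the fixed-point subalgebra of the C*-system
(C(S), h \<mapsto> h \<circ> \<Phi>) where S is a compact space: for every continuous complex
function h on S, the Cesaro averages (1/n) \<Sum>_{k<n} h \<circ> \<Phi>^k converge in
the sup norm (to an element of C(S)).\<close>
definition uniquely_ergodic_fixed :: "'b::topological_space set \<Rightarrow> ('b \<Rightarrow> 'b) \<Rightarrow> bool" where
  "uniquely_ergodic_fixed S \<Phi> \<longleftrightarrow>
     (\<forall>h :: 'b \<Rightarrow> complex. continuous_on S h \<longrightarrow>
        (\<exists>L. continuous_on S L \<and>
             uniform_limit S (\<lambda>n p. (\<Sum>k<n. h ((\<Phi> ^^ k) p)) / of_nat n) L sequentially))"

end

theory Submission
  imports Defs
begin

text \<open>On functions \<open>F(x) w\<^sup>n\<close>, whose span is dense by Stone--Weierstrass, the skew product acts by the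
weighted operator \<open>U F = f\<^sup>n \<cdot> (F \<circ> \<theta>)\<close>, so the question is whether, for each \<open>n\<close>, the
averages \<open>A\<^sub>N F\<close> of \<open>U\<close> converge uniformly for all continuous \<open>F\<close>.

If the bounded fixed functions of \<open>U\<close> are continuous, the mean ergodic theorem gives a fixed \<open>G\<close> with
\<open>A\<^sub>N F \<rightarrow> G\<close> in mean along a subsequence, and \<open>G\<close> may be taken continuous. Since
\<open>A\<^sub>N (F - G)\<close> is uniformly close to \<open>A\<^sub>N A\<^sub>M (F - G)\<close> for \<open>N\<close> large, which is dominated
by the unweighted average of \<open>\<bar>A\<^sub>M (F - G)\<bar>\<close>, unique ergodicity of \<open>\<theta>\<close> turns smallness in mean of
\<open>A\<^sub>M (F - G)\<close> into uniform smallness of \<open>A\<^sub>N (F - G)\<close>.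

Conversely, if the averages converge uniformly and \<open>g\<close> is a nonzero bounded fixed function, the limit of
\<open>A\<^sub>N F\<close> for a continuous \<open>F\<close> close to \<open>g\<close> in mean is a continuous fixed function; its product with
the conjugate of \<open>g\<close> is invariant, hence constant, which makes \<open>g\<close> a multiple of it.\<close>

section \<open>The Riesz--Markov theorem on compact Hausdorff spaces\<close>

text \<open>The space need not be metrizable, and unique ergodicity speaks of regular measures only;
  both facts shape the first half. Functionals on the continuous functions need not have convergent
  subsequences, so the invariant functional is a cluster point along a filter. It contradicts
  uniqueness only after it has been represented by a measure that is both regular and invariant,
  hence Riesz--Markov comes with these two properties. Likewise ergodicity of \<open>\<mu>\<close>
  rests on bounded densities preserving regularity, and regularity returns in the \<open>L^1\<close>
  density of continuous functions.

  The mean ergodic theorem comes from minimising the \<open>L^2\<close> norm over the averages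
  \<open>A N F\<close> themselves, which are continuous. As \<open>A K (A M F)\<close> is uniformly
  close to \<open>A K F\<close> for large \<open>K\<close>, later averages are almost as small as
  any earlier one, and midpoints of two averages cannot undercut the infimum; the parallelogram law
  then gives a Cauchy property. Completeness of \<open>L^2\<close> is bypassed: along a fast
  subsequence the increments are summable almost everywhere.\<close>

lemma compact_t2_Urysohn:
  fixes A B :: "'a::t2_space set"
  assumes "compact (UNIV :: 'a set)" "closed A" "closed B" "A \<inter> B = {}"
  obtains \<psi> :: "'a \<Rightarrow> real" where "continuous_on UNIV \<psi>" "\<And>x. 0 \<le> \<psi> x" "\<And>x. \<psi> x \<le> 1"
    "\<And>x. x \<in> A \<Longrightarrow> \<psi> x = 0" "\<And>x. x \<in> B \<Longrightarrow> \<psi> x = 1"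
proof -
  have "normal_space (euclidean :: 'a topology)"
    using assms(1) by (intro compact_Hausdorff_or_regular_imp_normal_space) (auto simp: compact_space_def Hausdorff_space_def separation_t2 disjnt_def)
  then obtain \<psi> where \<psi>: "continuous_map euclidean (top_of_set {0..1::real}) \<psi>" "\<psi> ` A \<subseteq> {0}" "\<psi> ` B \<subseteq> {1}"
    using Urysohn_lemma[of euclidean A B 0 1] assms by (auto simp: disjnt_def)
  show ?thesis
  proof (rule that)
    show "continuous_on UNIV \<psi>" using \<psi>(1) by (simp add: continuous_map_in_subtopology)
    have "\<psi> x \<in> {0..1}" for x
      using \<psi>(1) by (auto simp: continuous_map_in_subtopology image_subset_iff)
    then show "\<And>x. 0 \<le> \<psi> x" "\<And>x. \<psi> x \<le> 1" by auto
  qed (use \<psi> in auto)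
qed

lemma continuous_norm_bound:
  fixes \<phi> :: "'a::t2_space \<Rightarrow> 'b::real_normed_vector"
  assumes "compact (UNIV :: 'a set)" "continuous_on UNIV \<phi>"
  obtains C where "0 < C" "\<And>x. norm (\<phi> x) \<le> C"
proof -
  have "bounded (range \<phi>)" using compact_continuous_image[OF assms(2,1)] compact_imp_bounded by blast
  then show ?thesis using that by (auto simp: bounded_pos)
qed

text \<open>\<open>\<Lambda>\<close> is total on all real functions, but the axioms constrain it
  only on continuous ones; its values elsewhere are junk.\<close>

locale positive_functional =
  fixes \<Lambda> :: "('a::t2_space \<Rightarrow> real) \<Rightarrow> real"
  assumes compact_UNIV: "compact (UNIV :: 'a set)"
    and add: "continuous_on UNIV \<phi> \<Longrightarrow> continuous_on UNIV \<psi> \<Longrightarrow> \<Lambda> (\<lambda>x. \<phi> x + \<psi> x) = \<Lambda> \<phi> + \<Lambda> \<psi>"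
    and scale: "continuous_on UNIV \<phi> \<Longrightarrow> \<Lambda> (\<lambda>x. c * \<phi> x) = c * \<Lambda> \<phi>"
    and nonneg: "continuous_on UNIV \<phi> \<Longrightarrow> (\<And>x. 0 \<le> \<phi> x) \<Longrightarrow> 0 \<le> \<Lambda> \<phi>"
    and one: "\<Lambda> (\<lambda>_. 1) = 1"
begin

lemma mono:
  assumes "continuous_on UNIV \<phi>" "continuous_on UNIV \<psi>" "\<And>x. \<phi> x \<le> \<psi> x"
  shows "\<Lambda> \<phi> \<le> \<Lambda> \<psi>"
proof -
  have "0 \<le> \<Lambda> (\<lambda>x. \<psi> x + (-1) * \<phi> x)"
    by (rule nonneg) (auto intro!: continuous_intros assms simp: assms)
  also have "\<dots> = \<Lambda> \<psi> + (-1) * \<Lambda> \<phi>"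
    by (subst add, (intro continuous_intros assms)+) (simp only: scale[OF assms(1)])
  finally show ?thesis by simp
qed

lemma const: "\<Lambda> (\<lambda>_. c) = c"
  using scale[of "\<lambda>_. 1" c] one by simp

section \<open>Test functions and the outer measure they generate\<close>

definition below :: "'a set \<Rightarrow> ('a \<Rightarrow> real) set" where
  "below U = {\<phi>. continuous_on UNIV \<phi> \<and> (\<forall>x. 0 \<le> \<phi> x \<and> \<phi> x \<le> indicator U x)}"

lemma belowD:
  assumes "\<phi> \<in> below U"
  shows "continuous_on UNIV \<phi>" "0 \<le> \<phi> x" "\<phi> x \<le> 1" "x \<notin> U \<Longrightarrow> \<phi> x = 0"
proof -
  have *: "continuous_on UNIV \<phi>" "0 \<le> \<phi> x" "\<phi> x \<le> indicator U x" for x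
    using assms by (auto simp: below_def)
  show "continuous_on UNIV \<phi>" "0 \<le> \<phi> x" by (rule *)+
  show "\<phi> x \<le> 1" using *(3)[of x] by (cases "x \<in> U") auto
  show "\<phi> x = 0" if "x \<notin> U" using *(2,3)[of x] that by auto
qed

lemma belowI:
  assumes "continuous_on UNIV \<phi>" "\<And>x. 0 \<le> \<phi> x" "\<And>x. \<phi> x \<le> 1" "\<And>x. x \<notin> U \<Longrightarrow> \<phi> x \<le> 0"
  shows "\<phi> \<in> below U"
  using assms by (auto simp: below_def indicator_def)

lemma below_truncate:
  assumes "\<phi> \<in> below U" "0 < e" "{x. e < \<phi> x} \<subseteq> V"
  shows "(\<lambda>x. max 0 (\<phi> x - e)) \<in> below V"
proof (rule belowI)
  show "continuous_on UNIV (\<lambda>x. max 0 (\<phi> x - e))"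
    by (intro continuous_intros belowD(1)[OF assms(1)])
  show "max 0 (\<phi> x - e) \<le> 1" for x using belowD(3)[OF assms(1), of x] assms(2) by auto
  show "max 0 (\<phi> x - e) \<le> 0" if "x \<notin> V" for x using assms(3) that by (force simp: max_def)
qed auto

lemma le_truncate:
  assumes "continuous_on UNIV \<phi>"
  shows "\<Lambda> \<phi> \<le> e + \<Lambda> (\<lambda>x. max 0 (\<phi> x - e))"
proof -
  have c: "continuous_on UNIV (\<lambda>x. max 0 (\<phi> x - e))" by (intro continuous_intros assms)
  have "\<Lambda> \<phi> \<le> \<Lambda> (\<lambda>x. e + max 0 (\<phi> x - e))"
    by (rule mono) (auto intro!: continuous_intros assms)
  also have "\<dots> = e + \<Lambda> (\<lambda>x. max 0 (\<phi> x - e))"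
    by (subst add) (auto intro!: c simp: const)
  finally show ?thesis .
qed

text \<open>The outer measure is built from open sets as in the usual proof, but test functions are only
  required to vanish off \<open>U\<close>, not to have support in \<open>U\<close>; truncating them at height \<open>e\<close> recovers
  compactness at the cost of \<open>e\<close>.\<close>
definition lam :: "'a set \<Rightarrow> ennreal" where
  "lam U = (SUP \<phi>\<in>below U. ennreal (\<Lambda> \<phi>))"

definition outer :: "'a set \<Rightarrow> ennreal" where
  "outer E = (INF U\<in>{U. open U \<and> E \<subseteq> U}. lam U)"

lemma zero_below: "(\<lambda>_. 0) \<in> below U"
  by (rule belowI) auto

lemma lam_upper: "\<phi> \<in> below U \<Longrightarrow> ennreal (\<Lambda> \<phi>) \<le> lam U"
  unfolding lam_def by (rule SUP_upper)

lemma lam_mono: "U \<subseteq> V \<Longrightarrow> lam U \<le> lam V"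
  unfolding lam_def
  by (rule SUP_subset_mono) (auto simp: below_def intro: order_trans[OF _ indicator_leI])

lemma lam_le_1: "lam U \<le> 1"
  unfolding lam_def
proof (rule SUP_least)
  fix \<phi> assume \<phi>: "\<phi> \<in> below U"
  have "\<Lambda> \<phi> \<le> \<Lambda> (\<lambda>_. 1)" by (rule mono) (auto intro: belowD[OF \<phi>])
  then show "ennreal (\<Lambda> \<phi>) \<le> 1" using one by simp
qed

lemma lam_UNIV: "lam UNIV = 1"
proof (rule antisym)
  have "(\<lambda>_. 1) \<in> below UNIV" by (rule belowI) auto
  from lam_upper[OF this] show "1 \<le> lam UNIV" by (simp add: one)
qed (rule lam_le_1)

lemma lam_empty: "lam {} = 0"
proof -
  have "ennreal (\<Lambda> \<phi>) \<le> 0" if "\<phi> \<in> below {}" for \<phi>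
  proof -
    have "\<phi> = (\<lambda>_. 0)" using belowD(4)[OF that] by auto
    then show ?thesis by (simp add: const)
  qed
  then show ?thesis unfolding lam_def by (metis SUP_least le_zero_eq)
qed

lemma lam_approx:
  assumes "0 < e"
  obtains \<phi> where "\<phi> \<in> below U" "lam U \<le> ennreal (\<Lambda> \<phi>) + ennreal e"
proof (cases "lam U = 0")
  case True
  then show ?thesis using that[OF zero_below] by simp
next
  case False
  have t: "lam U \<noteq> \<top>" using lam_le_1[of U] by (auto simp: top_unique)
  have "lam U - ennreal e < lam U"
    using False t assms by (intro ennreal_between) (auto simp: less_top zero_less_iff_neq_zero)
  then obtain \<phi> where "\<phi> \<in> below U" "lam U - ennreal e < ennreal (\<Lambda> \<phi>)"
    unfolding lam_def less_SUP_iff by auto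
  then have "lam U \<le> ennreal (\<Lambda> \<phi>) + ennreal e"
    by (metis ennreal_minus_le_iff add.commute less_imp_le)
  then show ?thesis using that \<open>\<phi> \<in> below U\<close> by blast
qed

text \<open>A two-piece partition of unity: \<open>\<psi>\<close> splits the truncated test function
  \<open>?t\<close> into \<open>?t * \<psi>\<close>, which vanishes off \<open>U\<close>, and
  \<open>?t * (1 - \<psi>)\<close>, which vanishes off \<open>V\<close> because \<open>?t\<close> is
  zero off \<open>K\<close> and \<open>\<psi>\<close> is 1 on \<open>K - V\<close>.\<close>

lemma lam_Un:
  assumes "open U" "open V"
  shows "lam (U \<union> V) \<le> lam U + lam V"
  unfolding lam_def[of "U \<union> V"]
proof (rule SUP_least, rule ennreal_le_epsilon)
  fix \<phi> and e :: real assume \<phi>: "\<phi> \<in> below (U \<union> V)" and e: "0 < e"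
  note c[continuous_intros] = belowD(1)[OF \<phi>]
  define K where "K = {x. e \<le> \<phi> x}"
  have K: "closed K" unfolding K_def by (intro closed_Collect_le continuous_intros)
  have KUV: "K \<subseteq> U \<union> V" using belowD(4)[OF \<phi>] e by (force simp: K_def)
  obtain \<psi> :: "'a \<Rightarrow> real" where \<psi>[continuous_intros]: "continuous_on UNIV \<psi>"
    and \<psi>': "\<And>x. 0 \<le> \<psi> x" "\<And>x. \<psi> x \<le> 1" "\<And>x. x \<in> - U \<Longrightarrow> \<psi> x = 0" "\<And>x. x \<in> K - V \<Longrightarrow> \<psi> x = 1"
    by (rule compact_t2_Urysohn[OF compact_UNIV, of "-U" "K - V"]) (use K KUV assms in \<open>auto intro: closed_Diff\<close>)
  let ?t = "\<lambda>x. max 0 (\<phi> x - e)"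
  have t: "0 \<le> ?t x" "?t x \<le> 1" for x using belowD(2,3)[OF \<phi>, of x] e by auto
  have a: "(\<lambda>x. ?t x * \<psi> x) \<in> below U"
    by (rule belowI) (auto intro!: continuous_intros mult_le_one t(2) simp: \<psi>')
  have "?t x * (1 - \<psi> x) \<le> 0" if "x \<notin> V" for x
    using \<psi>'(4)[of x] that by (cases "x \<in> K") (auto simp: K_def max_def)
  then have b: "(\<lambda>x. ?t x * (1 - \<psi> x)) \<in> below V"
    by (intro belowI) (auto intro!: continuous_intros mult_le_one t(2) simp: \<psi>')
  have "\<Lambda> \<phi> \<le> e + \<Lambda> ?t" by (rule le_truncate) (rule c)
  also have "?t = (\<lambda>x. ?t x * \<psi> x + ?t x * (1 - \<psi> x))" by (auto simp: algebra_simps)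
  also have "\<Lambda> \<dots> = \<Lambda> (\<lambda>x. ?t x * \<psi> x) + \<Lambda> (\<lambda>x. ?t x * (1 - \<psi> x))"
    by (rule add) (auto intro!: continuous_intros)
  finally have "ennreal (\<Lambda> \<phi>) \<le> ennreal (\<Lambda> (\<lambda>x. ?t x * \<psi> x)) + ennreal (\<Lambda> (\<lambda>x. ?t x * (1 - \<psi> x))) + ennreal e"
    using nonneg[OF belowD(1)[OF a] belowD(2)[OF a]] nonneg[OF belowD(1)[OF b] belowD(2)[OF b]] e
    by (simp flip: ennreal_plus add: ennreal_leI)
  also have "\<dots> \<le> lam U + lam V + ennreal e"
    by (intro add_mono lam_upper a b) auto
  finally show "ennreal (\<Lambda> \<phi>) \<le> lam U + lam V + ennreal e" .
qed

lemma lam_UN_finite: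
  assumes "finite I" "\<And>i. open (U i)"
  shows "lam (\<Union>i\<in>I. U i) \<le> (\<Sum>i\<in>I. lam (U i))"
  using assms(1)
proof (induction I rule: finite_induct)
  case empty
  show ?case by (simp add: lam_empty)
next
  case (insert i I)
  have "lam (\<Union>i\<in>insert i I. U i) \<le> lam (U i) + lam (\<Union>i\<in>I. U i)"
    using lam_Un[of "U i" "\<Union>i\<in>I. U i"] assms(2) by (simp add: open_UN)
  also have "\<dots> \<le> lam (U i) + (\<Sum>i\<in>I. lam (U i))"
    by (rule add_left_mono) (rule insert.IH)
  also have "\<dots> = (\<Sum>i\<in>insert i I. lam (U i))"
    using insert.hyps by simp
  finally show ?case .
qed

text \<open>Truncation leaves a function living on a superlevel set, which is compact; finitely many
  \<open>U i\<close> cover it, so the finite case applies up to \<open>e\<close>.\<close>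

lemma lam_UN:
  fixes U :: "nat \<Rightarrow> 'a set"
  assumes "\<And>i. open (U i)"
  shows "lam (\<Union>i. U i) \<le> (\<Sum>i. lam (U i))"
  unfolding lam_def[of "\<Union>i. U i"]
proof (rule SUP_least, rule ennreal_le_epsilon)
  fix \<phi> and e :: real assume \<phi>: "\<phi> \<in> below (\<Union>i. U i)" and e: "0 < e"
  have "closed {x. e \<le> \<phi> x}" by (intro closed_Collect_le continuous_intros belowD(1)[OF \<phi>])
  then have "compact {x. e \<le> \<phi> x}" using compact_UNIV by (metis compact_Int_closed inf_top_left)
  moreover have "{x. e \<le> \<phi> x} \<subseteq> (\<Union>i\<in>UNIV. U i)" using belowD(4)[OF \<phi>] e by force
  ultimately obtain I where I: "finite I" "{x. e \<le> \<phi> x} \<subseteq> (\<Union>i\<in>I. U i)"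
    by (elim compactE_image) (use assms in auto)
  let ?t = "\<lambda>x. max 0 (\<phi> x - e)"
  have b: "?t \<in> below (\<Union>i\<in>I. U i)" using I(2) by (intro below_truncate[OF \<phi> e]) force
  have "\<Lambda> \<phi> \<le> e + \<Lambda> ?t" by (rule le_truncate) (rule belowD(1)[OF \<phi>])
  then have "ennreal (\<Lambda> \<phi>) \<le> ennreal (\<Lambda> ?t) + ennreal e"
    using nonneg[OF belowD(1)[OF b] belowD(2)[OF b]] e by (simp flip: ennreal_plus add: ennreal_leI)
  also have "\<dots> \<le> lam (\<Union>i\<in>I. U i) + ennreal e" by (intro add_right_mono lam_upper b)
  also have "\<dots> \<le> (\<Sum>i\<in>I. lam (U i)) + ennreal e" by (intro add_right_mono lam_UN_finite I assms)
  also have "\<dots> \<le> (\<Sum>i. lam (U i)) + ennreal e" by (intro add_right_mono sum_le_suminf I(1)) auto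
  finally show "ennreal (\<Lambda> \<phi>) \<le> (\<Sum>i. lam (U i)) + ennreal e" .
qed

lemma outer_open: "open U \<Longrightarrow> outer U = lam U"
  unfolding outer_def by (intro antisym INF_greatest INF_lower lam_mono) auto

lemma outer_mono: "A \<subseteq> B \<Longrightarrow> outer A \<le> outer B"
  unfolding outer_def by (rule INF_superset_mono) auto

lemma outer_le: "open U \<Longrightarrow> E \<subseteq> U \<Longrightarrow> outer E \<le> lam U"
  unfolding outer_def by (rule INF_lower) auto

lemma outer_approx:
  assumes "0 < e"
  obtains U where "open U" "E \<subseteq> U" "lam U \<le> outer E + ennreal e"
proof -
  have t: "outer E \<noteq> \<top>" using outer_le[of UNIV E] lam_UNIV by (auto simp: top_unique)
  have "outer E < outer E + ennreal e" using t assms by (simp add: ennreal_add_left_cancel_less less_top zero_less_iff_neq_zero)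
  then obtain U where "open U" "E \<subseteq> U" "lam U < outer E + ennreal e"
    unfolding outer_def[of E] INF_less_iff by auto
  then show ?thesis using that by (meson less_imp_le)
qed

lemma outer_countably_subadditive:
  fixes E :: "nat \<Rightarrow> 'a set"
  shows "outer (\<Union>i. E i) \<le> (\<Sum>i. outer (E i))"
proof (rule ennreal_le_epsilon)
  fix e :: real assume e: "0 < e"
  have "\<exists>U. open U \<and> E i \<subseteq> U \<and> lam U \<le> outer (E i) + ennreal (e * (1/2)^Suc i)" for i
    using outer_approx[of "e * (1/2)^Suc i" "E i"] e by (metis mult_pos_pos zero_less_power half_gt_zero_iff zero_less_one)
  then obtain U where U: "\<And>i. open (U i)" "\<And>i. E i \<subseteq> U i"
    "\<And>i. lam (U i) \<le> outer (E i) + ennreal (e * (1/2)^Suc i)" by metis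
  have "outer (\<Union>i. E i) \<le> lam (\<Union>i. U i)" using U by (intro outer_le) auto
  also have "\<dots> \<le> (\<Sum>i. lam (U i))" by (rule lam_UN) (rule U)
  also have "\<dots> \<le> (\<Sum>i. outer (E i) + ennreal (e * (1/2)^Suc i))" by (intro suminf_le U) auto
  also have "\<dots> = (\<Sum>i. outer (E i)) + (\<Sum>i. ennreal (e * (1/2)^Suc i))"
    by (rule suminf_add[symmetric]) auto
  also have "(\<Sum>i. ennreal (e * (1/2)^Suc i)) = ennreal (e * 1)"
    by (rule suminf_ennreal_eq[OF _ sums_mult[OF power_half_series]]) (use e in simp)
  also have "ennreal (e * 1) = ennreal e" by simp
  finally show "outer (\<Union>i. E i) \<le> (\<Sum>i. outer (E i)) + ennreal e" .
qed

lemma outer_empty: "outer {} = 0"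
  using outer_open[of "{}"] lam_empty by simp

lemma outer_measure_space_outer: "outer_measure_space (Pow UNIV) outer"
  unfolding outer_measure_space_def
  by (auto simp: positive_def increasing_def countably_subadditive_def outer_empty outer_mono
      intro: outer_countably_subadditive)

lemma outer_Un: "outer (A \<union> B) \<le> outer A + outer B"
proof -
  interpret sigma_algebra UNIV "Pow (UNIV :: 'a set)" by (rule sigma_algebra_Pow)
  have "subadditive (Pow UNIV) outer"
    using outer_measure_space_outer countably_subadditive_subadditive unfolding outer_measure_space_def by blast
  have "outer (A \<union> (B - A)) \<le> outer A + outer (B - A)"
    by (rule subadditiveD[OF \<open>subadditive (Pow UNIV) outer\<close>]) auto
  also have "\<dots> \<le> outer A + outer B" by (intro add_left_mono outer_mono) auto
  finally show ?thesis by simp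
qed

text \<open>Caratheodory's condition for \<open>U\<close>, tested on open \<open>V\<close>. The
  order of choices matters: \<open>\<phi>\<close> is nearly optimal for \<open>V \<inter> U\<close>,
  then \<open>\<psi>\<close> for \<open>V - K\<close> with \<open>K\<close> a superlevel set of
  \<open>\<phi>\<close>. The truncated \<open>\<phi>\<close> lives on \<open>K\<close>, where
  \<open>\<psi>\<close> vanishes, so their sum is still a test function for \<open>V\<close>. Two
  near-optimal choices and one truncation cost \<open>e/3\<close> each.\<close>

lemma lam_split:
  assumes "open U" "open V"
  shows "lam (V \<inter> U) + outer (V - U) \<le> lam V"
proof (rule ennreal_le_epsilon)
  fix e :: real assume e: "0 < e"
  obtain \<phi> where \<phi>: "\<phi> \<in> below (V \<inter> U)" "lam (V \<inter> U) \<le> ennreal (\<Lambda> \<phi>) + ennreal (e/3)"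
    using lam_approx[of "e/3"] e by auto
  define K where "K = {x. e/3 \<le> \<phi> x}"
  have "closed K" unfolding K_def by (intro closed_Collect_le continuous_intros belowD(1)[OF \<phi>(1)])
  then have o: "open (V - K)" using assms by auto
  have K: "K \<subseteq> V \<inter> U" using belowD(4)[OF \<phi>(1)] e by (force simp: K_def)
  obtain \<psi> where \<psi>: "\<psi> \<in> below (V - K)" "lam (V - K) \<le> ennreal (\<Lambda> \<psi>) + ennreal (e/3)"
    using lam_approx[of "e/3"] e by auto
  let ?t = "\<lambda>x. max 0 (\<phi> x - e/3)"
  have t: "?t \<in> below K" using e by (intro below_truncate[OF \<phi>(1)]) (auto simp: K_def)
  have s: "(\<lambda>x. ?t x + \<psi> x) \<in> below V"
  proof (rule belowI)
    show "?t x + \<psi> x \<le> 1" for x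
      using belowD(3,4)[OF t, of x] belowD(3,4)[OF \<psi>(1), of x] by (cases "x \<in> K") auto
    show "?t x + \<psi> x \<le> 0" if "x \<notin> V" for x
    proof -
      have "x \<notin> K" using K that by blast
      then show ?thesis using belowD(4)[OF t, of x] belowD(4)[OF \<psi>(1), of x] that by simp
    qed
  qed (use belowD[OF t] belowD[OF \<psi>(1)] in \<open>auto intro!: continuous_intros\<close>)
  have "\<Lambda> \<phi> + \<Lambda> \<psi> \<le> e/3 + \<Lambda> (\<lambda>x. ?t x + \<psi> x)"
    using le_truncate[OF belowD(1)[OF \<phi>(1)], of "e/3"] add[OF belowD(1)[OF t] belowD(1)[OF \<psi>(1)]] by auto
  then have *: "ennreal (\<Lambda> \<phi>) + ennreal (\<Lambda> \<psi>) \<le> ennreal (\<Lambda> (\<lambda>x. ?t x + \<psi> x)) + ennreal (e/3)"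
    using nonneg[OF belowD(1)[OF \<phi>(1)] belowD(2)[OF \<phi>(1)]] nonneg[OF belowD(1)[OF \<psi>(1)] belowD(2)[OF \<psi>(1)]]
      nonneg[OF belowD(1)[OF s] belowD(2)[OF s]] e
    by (simp flip: ennreal_plus add: ennreal_leI)
  have "outer (V - U) \<le> lam (V - K)" using o K by (intro outer_le) auto
  then have "lam (V \<inter> U) + outer (V - U) \<le> (ennreal (\<Lambda> \<phi>) + ennreal (e/3)) + (ennreal (\<Lambda> \<psi>) + ennreal (e/3))"
    using \<phi>(2) \<psi>(2) by (intro add_mono) auto
  also have "\<dots> = (ennreal (\<Lambda> \<phi>) + ennreal (\<Lambda> \<psi>)) + (ennreal (e/3) + ennreal (e/3))" by (simp add: ac_simps)
  also have "\<dots> \<le> (ennreal (\<Lambda> (\<lambda>x. ?t x + \<psi> x)) + ennreal (e/3)) + (ennreal (e/3) + ennreal (e/3))"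
    by (intro add_right_mono *)
  also have "\<dots> = ennreal (\<Lambda> (\<lambda>x. ?t x + \<psi> x)) + ennreal e"
    using e by (simp add: add.assoc flip: ennreal_plus)
  also have "\<dots> \<le> lam V + ennreal e" by (intro add_right_mono lam_upper s)
  finally show "lam (V \<inter> U) + outer (V - U) \<le> lam V + ennreal e" .
qed

text \<open>An arbitrary \<open>E\<close> is replaced by an open superset of nearly the same outer
  measure, where \<open>lam_split\<close> applies. By Caratheodory's theorem all Borel sets then
  become measurable for \<open>outer\<close>.\<close>

lemma open_lambda_system:
  assumes "open U"
  shows "U \<in> lambda_system UNIV (Pow UNIV) outer"
  unfolding lambda_system_def
proof (intro CollectI conjI ballI)
  fix E :: "'a set"
  have "outer (U \<inter> E) + outer ((UNIV - U) \<inter> E) \<le> outer E"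
  proof (rule ennreal_le_epsilon)
    fix e :: real assume "0 < e"
    then obtain V where V: "open V" "E \<subseteq> V" "lam V \<le> outer E + ennreal e" using outer_approx by blast
    have "outer (U \<inter> E) + outer ((UNIV - U) \<inter> E) \<le> lam (V \<inter> U) + outer (V - U)"
      using V assms by (intro add_mono outer_le outer_mono) auto
    also have "\<dots> \<le> lam V" by (rule lam_split) (use assms V in auto)
    also note V(3)
    finally show "outer (U \<inter> E) + outer ((UNIV - U) \<inter> E) \<le> outer E + ennreal e" .
  qed
  moreover have "outer E \<le> outer (U \<inter> E) + outer ((UNIV - U) \<inter> E)"
    using outer_Un[of "U \<inter> E" "(UNIV - U) \<inter> E"] by (metis Int_Un_distrib2 Un_Diff_cancel Int_UNIV_left sup_top_right)
  ultimately show "outer (U \<inter> E) + outer ((UNIV - U) \<inter> E) = outer E" by (rule antisym)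
qed auto

text \<open>\<open>measure_of\<close> yields zero on every set unless \<open>outer\<close> is a
  measure on the Borel sets, so this has content only through
  \<open>emeasure_rmeasure\<close>.\<close>

definition rmeasure :: "'a measure" where
  "rmeasure = measure_of UNIV (sets borel) outer"

lemma sets_rmeasure[simp, measurable_cong]: "sets rmeasure = sets borel"
  by (metis rmeasure_def sets.sigma_sets_eq sets_measure_of space_borel sets.space_closed)

lemma space_rmeasure[simp]: "space rmeasure = UNIV"
  using sets_eq_imp_space_eq[OF sets_rmeasure] by simp

lemma emeasure_rmeasure: "B \<in> sets borel \<Longrightarrow> emeasure rmeasure B = outer B"
proof (rule emeasure_measure_of[OF rmeasure_def])
  interpret sigma_algebra UNIV "Pow (UNIV :: 'a set)" by (rule sigma_algebra_Pow)
  let ?L = "lambda_system UNIV (Pow UNIV) outer"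
  have ms: "measure_space UNIV ?L outer" by (rule caratheodory_lemma[OF outer_measure_space_outer])
  interpret L: sigma_algebra UNIV ?L using ms by (simp add: measure_space_def)
  have "sigma_sets UNIV {S. open S} \<subseteq> ?L" by (rule L.sigma_sets_subset) (use open_lambda_system in blast)
  then have sub: "sets borel \<subseteq> ?L" by (simp add: borel_def)
  show "positive (sets rmeasure) outer" by (simp add: positive_def outer_empty)
  have "countably_additive ?L outer" using ms by (simp add: measure_space_def)
  then show "countably_additive (sets rmeasure) outer"
    using sub unfolding countably_additive_def sets_rmeasure by (meson order_trans subset_eq)
qed auto

lemma emeasure_rmeasure_open: "open U \<Longrightarrow> emeasure rmeasure U = lam U"
  by (simp add: emeasure_rmeasure outer_open)

text \<open>\<open>\<phi>\<close> vanishes off every open superset of \<open>B\<close>, hence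
  competes in each term of the infimum that defines \<open>outer B\<close>. \<open>B\<close> need
  not be open: closed superlevel sets serve for inner regularity, open ones for the
  integral.\<close>

lemma le_emeasure_superlevel:
  assumes "continuous_on UNIV \<phi>" "\<And>x. 0 \<le> \<phi> x" "\<And>x. \<phi> x \<le> 1" "\<And>x. x \<notin> B \<Longrightarrow> \<phi> x = 0" "B \<in> sets borel"
  shows "ennreal (\<Lambda> \<phi>) \<le> emeasure rmeasure B"
  unfolding emeasure_rmeasure[OF assms(5)] outer_def
proof (intro INF_greatest lam_upper belowI)
  fix U x assume "U \<in> {U. open U \<and> B \<subseteq> U}" "x \<notin> U"
  then have "x \<notin> B" by auto
  then show "\<phi> x \<le> 0" by (simp add: assms(4))
qed (rule assms)+

text \<open>Outer regularity is built into \<open>outer\<close>. For inner regularity of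
  \<open>U\<close>, a test function \<open>\<phi>\<close> loses at most \<open>e\<close> when
  truncated, and what remains is bounded by the measure of the compact set where
  \<open>e \<le> \<phi>\<close>.\<close>

lemma regular_rmeasure: "regular_borel_prob rmeasure"
  unfolding regular_borel_prob_def
proof (intro conjI ballI allI impI)
  show "prob_space rmeasure" by (rule prob_spaceI) (simp add: emeasure_rmeasure_open lam_UNIV)
  show "sets rmeasure = sets borel" by simp
  show "emeasure rmeasure B = (INF U\<in>{U. open U \<and> B \<subseteq> U}. emeasure rmeasure U)" if "B \<in> sets borel" for B
    using that by (auto simp: emeasure_rmeasure outer_def[of B] outer_open intro!: INF_cong)
  fix U :: "'a set" assume U: "open U"
  show "emeasure rmeasure U = (SUP K\<in>{K. compact K \<and> K \<subseteq> U}. emeasure rmeasure K)" (is "_ = ?S")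
  proof (rule antisym)
    show "?S \<le> emeasure rmeasure U"
      using U by (intro SUP_least emeasure_mono) auto
    show "emeasure rmeasure U \<le> ?S"
      unfolding emeasure_rmeasure_open[OF U] lam_def
    proof (rule SUP_least, rule ennreal_le_epsilon)
      fix \<phi> and e :: real assume \<phi>: "\<phi> \<in> below U" and e: "0 < e"
      have cl: "closed {x. e \<le> \<phi> x}" by (intro closed_Collect_le continuous_intros belowD(1)[OF \<phi>])
      then have co: "compact {x. e \<le> \<phi> x}" using compact_UNIV by (metis compact_Int_closed inf_top_left)
      let ?t = "\<lambda>x. max 0 (\<phi> x - e)"
      have t: "?t \<in> below {x. e \<le> \<phi> x}" using e by (intro below_truncate[OF \<phi>]) auto
      have "\<Lambda> \<phi> \<le> e + \<Lambda> ?t" by (rule le_truncate) (rule belowD(1)[OF \<phi>])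
      then have "ennreal (\<Lambda> \<phi>) \<le> ennreal (\<Lambda> ?t) + ennreal e"
        using nonneg[OF belowD(1)[OF t] belowD(2)[OF t]] e by (simp flip: ennreal_plus add: ennreal_leI)
      also have "\<dots> \<le> emeasure rmeasure {x. e \<le> \<phi> x} + ennreal e"
        using cl by (intro add_right_mono le_emeasure_superlevel belowD[OF t]) auto
      also have "\<dots> \<le> ?S + ennreal e"
        using belowD(4)[OF \<phi>] e co by (intro add_right_mono SUP_upper) force
      finally show "ennreal (\<Lambda> \<phi>) \<le> ?S + ennreal e" .
    qed
  qed
qed

section \<open>Representation of the functional as an integral\<close>

lemma sum_functional:
  fixes \<phi> :: "nat \<Rightarrow> 'a \<Rightarrow> real"
  assumes "\<And>i. i < n \<Longrightarrow> continuous_on UNIV (\<phi> i)"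
  shows "\<Lambda> (\<lambda>x. \<Sum>i<n. \<phi> i x) = (\<Sum>i<n. \<Lambda> (\<phi> i))"
  using assms
proof (induction n)
  case 0 show ?case by (simp add: const)
next
  case (Suc n)
  have "\<Lambda> (\<lambda>x. (\<Sum>i<n. \<phi> i x) + \<phi> n x) = \<Lambda> (\<lambda>x. \<Sum>i<n. \<phi> i x) + \<Lambda> (\<phi> n)"
    by (rule add) (auto intro!: continuous_intros Suc.prems)
  then show ?case using Suc by simp
qed

sublocale R: prob_space rmeasure
  using regular_rmeasure by (simp add: regular_borel_prob_def)

lemmas bounded_continuous = continuous_norm_bound[where 'b = real, OF compact_UNIV, unfolded real_norm_def]

lemma integrable_continuous:
  fixes \<phi> :: "'a \<Rightarrow> real"
  assumes "continuous_on UNIV \<phi>"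
  shows "integrable rmeasure \<phi>"
proof -
  obtain C where "\<And>x. \<bar>\<phi> x\<bar> \<le> C" using bounded_continuous[OF assms] by blast
  then show ?thesis
    using borel_measurable_continuous_onI[OF assms] by (intro R.integrable_const_bound[of _ C]) auto
qed

text \<open>Each slice scaled by \<open>n\<close> has values in the unit interval and vanishes off
  the superlevel set \<open>B i\<close>, so the functional is at most the measure of
  \<open>B i\<close> there; the resulting step function exceeds \<open>\<phi>\<close> by at most
  \<open>1/n\<close>. One inequality suffices, as the other follows by passing to
  \<open>-\<phi>\<close>.\<close>

lemma functional_le_integral_unit:
  assumes c: "continuous_on UNIV \<phi>" and nn: "\<And>x. 0 \<le> \<phi> x" and le1: "\<And>x. \<phi> x \<le> 1"
  shows "\<Lambda> \<phi> \<le> (\<integral>x. \<phi> x \<partial>rmeasure)"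
proof (rule field_le_epsilon)
  fix e :: real assume e: "0 < e"
  obtain n :: nat where n: "0 < n" "1 / n < e"
    using e by (metis nat_approx_posE less_nat_zero_code of_nat_0_less_iff zero_less_Suc)
  \<comment> \<open>layer-cake decomposition of \<open>\<phi>\<close> into \<open>n\<close> slices of height \<open>1/n\<close>\<close>
  define \<phi>' where "\<phi>' i x = min (1/n) (max 0 (\<phi> x - i/n))" for i :: nat and x
  define B where "B i = {x. i/n < \<phi> x}" for i :: nat
  have c': "continuous_on UNIV (\<phi>' i)" for i unfolding \<phi>'_def by (intro continuous_intros c)
  have B: "B i \<in> sets borel" for i
    unfolding B_def by (intro borel_open open_Collect_less continuous_intros c)
  have tel: "(\<Sum>i<m. \<phi>' i x) = min (\<phi> x) (m/n)" for m x
  proof (induction m)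
    case 0 show ?case using nn[of x] by simp
  next
    case (Suc m)
    define a b where "a = real m / n" and "b = 1 / real n"
    have "0 < b" using n(1) by (simp add: b_def)
    moreover have "(\<Sum>i<m. \<phi>' i x) = min (\<phi> x) a" "\<phi>' m x = min b (max 0 (\<phi> x - a))"
      using Suc.IH by (simp_all add: \<phi>'_def a_def b_def)
    moreover have "real (Suc m) / n = a + b" by (simp add: a_def b_def add_divide_distrib)
    ultimately show ?case using nn[of x] by (simp only: sum.lessThan_Suc)
  qed
  \<comment> \<open>For \<open>\<phi> x \<ge> 0\<close>, the number of levels \<open>i/n\<close>
    strictly below \<open>\<phi> x\<close> exceeds \<open>n * \<phi> x\<close> by less than one,
    which is the extra \<open>1/n\<close>. The minimum with \<open>m/n\<close> carries the
    induction.\<close>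
  have cnt: "(\<Sum>i<m. 1/n * indicator (B i) x) \<le> min (\<phi> x + 1/n) (m/n)" for m x
  proof (induction m)
    case 0 show ?case using nn[of x] by simp
  next
    case (Suc m)
    have "(real (Suc m))/n = m/n + 1/n" by (simp add: add_divide_distrib)
    then show ?case using Suc n(1) by (auto simp: B_def indicator_def min_def split: if_splits)
  qed
  have \<phi>'_le: "\<Lambda> (\<phi>' i) \<le> 1/n * measure rmeasure (B i)" for i
  proof -
    have "ennreal (\<Lambda> (\<lambda>x. n * \<phi>' i x)) \<le> emeasure rmeasure (B i)"
      by (rule le_emeasure_superlevel[OF continuous_on_mult_left[OF c'] _ _ _ B])
        (use n in \<open>auto simp: \<phi>'_def B_def field_simps min_def max_def\<close>)
    then have "\<Lambda> (\<lambda>x. n * \<phi>' i x) \<le> measure rmeasure (B i)"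
      by (simp add: R.emeasure_eq_measure)
    then show ?thesis using n(1) by (simp add: scale[OF c'] field_simps)
  qed
  have "\<Lambda> \<phi> = \<Lambda> (\<lambda>x. \<Sum>i<n. \<phi>' i x)" using n le1 by (simp add: tel min_absorb1)
  also have "\<dots> = (\<Sum>i<n. \<Lambda> (\<phi>' i))" by (rule sum_functional) (rule c')
  also have "\<dots> \<le> (\<Sum>i<n. 1/n * measure rmeasure (B i))" by (rule sum_mono) (rule \<phi>'_le)
  also have "\<dots> = (\<integral>x. (\<Sum>i<n. 1/n * indicator (B i) x) \<partial>rmeasure)"
    using B by (subst Bochner_Integration.integral_sum) (auto simp: R.emeasure_eq_measure)
  also have "\<dots> \<le> (\<integral>x. \<phi> x + 1/n \<partial>rmeasure)"
  proof (rule integral_mono)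
    show "integrable rmeasure (\<lambda>x. \<Sum>i<n. 1/n * indicator (B i) x)"
      using B by (auto simp: R.emeasure_eq_measure)
    show "integrable rmeasure (\<lambda>x. \<phi> x + 1/n)" by (intro integrable_continuous continuous_intros c)
  qed (use cnt in auto)
  also have "\<dots> = (\<integral>x. \<phi> x \<partial>rmeasure) + 1/n"
    using integrable_continuous[OF c] R.prob_space by simp
  finally show "\<Lambda> \<phi> \<le> (\<integral>x. \<phi> x \<partial>rmeasure) + e" using n(2) by simp
qed

lemma functional_le_integral:
  assumes c: "continuous_on UNIV \<phi>"
  shows "\<Lambda> \<phi> \<le> (\<integral>x. \<phi> x \<partial>rmeasure)"
proof -
  obtain C where C: "0 < C" "\<And>x. \<bar>\<phi> x\<bar> \<le> C" using bounded_continuous[OF c] by blast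
  have "0 \<le> \<phi> x + C" "\<phi> x + C \<le> 2 * C" for x using C(2)[of x] by linarith+
  then have "\<Lambda> (\<lambda>x. (1/(2*C)) * (\<phi> x + C)) \<le> (\<integral>x. (1/(2*C)) * (\<phi> x + C) \<partial>rmeasure)"
    using C(1) by (intro functional_le_integral_unit)
      (force intro!: continuous_intros c simp: field_simps)+
  moreover have "\<Lambda> (\<lambda>x. (1/(2*C)) * (\<phi> x + C)) = (1/(2*C)) * (\<Lambda> \<phi> + C)"
    by (simp only: scale[OF continuous_on_add[OF c continuous_on_const]] add[OF c continuous_on_const] const)
  moreover have "(\<integral>x. (1/(2*C)) * (\<phi> x + C) \<partial>rmeasure) = (1/(2*C)) * ((\<integral>x. \<phi> x \<partial>rmeasure) + C)"
    using integrable_continuous[OF c] R.prob_space by (simp only: integral_mult_right_zero) simp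
  ultimately show ?thesis using C(1) by (simp only: mult_le_cancel_left_pos zero_less_divide_1_iff)
qed

theorem riesz_markov:
  assumes c: "continuous_on UNIV \<phi>"
  shows "(\<integral>x. \<phi> x \<partial>rmeasure) = \<Lambda> \<phi>"
proof (rule antisym)
  have "\<Lambda> (\<lambda>x. (-1) * \<phi> x) \<le> (\<integral>x. (-1) * \<phi> x \<partial>rmeasure)"
    by (rule functional_le_integral) (intro continuous_intros c)
  then show "(\<integral>x. \<phi> x \<partial>rmeasure) \<le> \<Lambda> \<phi>" unfolding scale[OF c] by simp
qed (rule functional_le_integral[OF c])

text \<open>Invariance passes from the functional to \<open>lam\<close> by transporting test
  functions along \<open>\<theta>\<close> and \<open>\<theta>'\<close>, and from \<open>lam\<close>
  to \<open>outer\<close> by transporting open supersets. The continuous inverse is what makes both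
  inequalities available.\<close>

lemma invariant_rmeasure:
  assumes hom: "homeomorphism UNIV UNIV \<theta> \<theta>'"
    and inv: "\<And>\<phi>. continuous_on UNIV \<phi> \<Longrightarrow> \<Lambda> (\<lambda>x. \<phi> (\<theta> x)) = \<Lambda> \<phi>"
  shows "invariant_measure \<theta> rmeasure"
proof -
  have ct: "continuous_on UNIV \<theta>" "continuous_on UNIV \<theta>'" and inverse: "\<theta> (\<theta>' x) = x" "\<theta>' (\<theta> x) = x" for x
    using hom by (auto simp: homeomorphism_def)
  note comp = continuous_on_compose2[OF _ _ subset_UNIV]
  have lam: "lam (\<theta> -` U) = lam U" for U
  proof (rule antisym)
    show "lam (\<theta> -` U) \<le> lam U" unfolding lam_def[of "\<theta> -` U"]
    proof (rule SUP_least)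
      fix \<phi> assume \<phi>: "\<phi> \<in> below (\<theta> -` U)"
      have c: "continuous_on UNIV (\<lambda>x. \<phi> (\<theta>' x))" by (rule comp[OF belowD(1)[OF \<phi>] ct(2)])
      have "\<Lambda> \<phi> = \<Lambda> (\<lambda>x. \<phi> (\<theta>' x))" using inv[OF c] by (simp add: inverse)
      moreover have "(\<lambda>x. \<phi> (\<theta>' x)) \<in> below U"
        by (rule belowI) (use belowD[OF \<phi>] c in \<open>auto simp: inverse\<close>)
      ultimately show "ennreal (\<Lambda> \<phi>) \<le> lam U" using lam_upper by metis
    qed
    show "lam U \<le> lam (\<theta> -` U)" unfolding lam_def[of U]
    proof (rule SUP_least)
      fix \<phi> assume \<phi>: "\<phi> \<in> below U"
      have c: "continuous_on UNIV (\<lambda>x. \<phi> (\<theta> x))" by (rule comp[OF belowD(1)[OF \<phi>] ct(1)])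
      have "(\<lambda>x. \<phi> (\<theta> x)) \<in> below (\<theta> -` U)"
        by (rule belowI) (use belowD[OF \<phi>] c in auto)
      then show "ennreal (\<Lambda> \<phi>) \<le> lam (\<theta> -` U)" using lam_upper inv[OF belowD(1)[OF \<phi>]] by metis
    qed
  qed
  have op: "open (\<theta> -` U)" "open (\<theta>' -` U)" if "open U" for U
    using ct that by (auto simp: continuous_on_open_vimage)
  have outer: "outer (\<theta> -` E) = outer E" for E
  proof (rule antisym)
    show "outer (\<theta> -` E) \<le> outer E" unfolding outer_def[of E]
    proof (rule INF_greatest)
      fix U assume "U \<in> {U. open U \<and> E \<subseteq> U}"
      then show "outer (\<theta> -` E) \<le> lam U" using outer_le[OF op(1), of U "\<theta> -` E"] lam by auto
    qed
    show "outer E \<le> outer (\<theta> -` E)" unfolding outer_def[of "\<theta> -` E"]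
    proof (rule INF_greatest)
      fix U assume U: "U \<in> {U. open U \<and> \<theta> -` E \<subseteq> U}"
      have "x \<in> \<theta>' -` U" if "x \<in> E" for x using U that inverse by auto
      then have "outer E \<le> lam (\<theta>' -` U)" using U by (intro outer_le op) auto
      also have "\<dots> = lam (\<theta> -` (\<theta>' -` U))" by (rule lam[symmetric])
      also have "\<theta> -` (\<theta>' -` U) = U" by (auto simp: inverse)
      finally show "outer E \<le> lam U" .
    qed
  qed
  have "\<theta> \<in> borel_measurable borel" using ct by (intro borel_measurable_continuous_onI)
  then have "\<theta> -` B \<in> sets borel" if "B \<in> sets borel" for B
    using measurable_sets[of \<theta> borel borel B] that by simp
  then show ?thesis by (auto simp: invariant_measure_def emeasure_rmeasure outer)
qed

end

section \<open>Uniquely ergodic homeomorphisms\<close>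

lemma regular_outer:
  assumes "regular_borel_prob M" "B \<in> sets borel" "0 < e"
  obtains U where "open U" "B \<subseteq> U" "measure M (U - B) < e"
proof -
  interpret prob_space M using assms(1) by (simp add: regular_borel_prob_def)
  have s[simp]: "sets M = sets borel" using assms(1) by (simp add: regular_borel_prob_def)
  have "emeasure M B < emeasure M B + ennreal e"
    using assms(3) by (simp add: emeasure_eq_measure ennreal_less_iff flip: ennreal_plus)
  moreover have "emeasure M B = (INF U\<in>{U. open U \<and> B \<subseteq> U}. emeasure M U)"
    using assms(1,2) unfolding regular_borel_prob_def by blast
  ultimately have "(INF U\<in>{U. open U \<and> B \<subseteq> U}. emeasure M U) < emeasure M B + ennreal e" by metis
  then obtain U where U: "open U" "B \<subseteq> U" "emeasure M U < emeasure M B + ennreal e"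
    unfolding INF_less_iff by blast
  have "measure M U < measure M B + e"
    using U(3) assms(3) by (simp add: emeasure_eq_measure ennreal_less_iff flip: ennreal_plus)
  moreover have "measure M (U - B) = measure M U - measure M B"
    using U assms(2) by (intro finite_measure_Diff) auto
  ultimately show ?thesis using that U by auto
qed

text \<open>In a compact space outer regularity implies inner regularity of open sets: if
  \<open>V\<close> is an open superset of \<open>- U\<close>, then \<open>- V\<close> is a compact
  subset of \<open>U\<close>, and \<open>U - - V\<close> equals the excess
  \<open>V - - U\<close>.\<close>

lemma regular_borel_probI:
  fixes M :: "'a::t2_space measure"
  assumes "compact (UNIV :: 'a set)" "prob_space M" and s[simp]: "sets M = sets borel"
    and outer: "\<And>B e. B \<in> sets borel \<Longrightarrow> 0 < e \<Longrightarrow> \<exists>U. open U \<and> B \<subseteq> U \<and> measure M (U - B) \<le> e"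
  shows "regular_borel_prob M"
  unfolding regular_borel_prob_def
proof (intro conjI ballI allI impI assms(2,3))
  interpret prob_space M by fact
  have step: "emeasure M A \<le> emeasure M C + ennreal e"
    if "A \<in> sets borel" "C \<in> sets borel" "C \<subseteq> A" "measure M (A - C) \<le> e" for A C e
  proof -
    have "measure M A \<le> measure M C + e"
      using finite_measure_Diff[of A C] that by simp
    moreover have "0 \<le> e" using that(4) measure_nonneg order_trans by blast
    ultimately show ?thesis by (simp add: emeasure_eq_measure ennreal_leI flip: ennreal_plus)
  qed
  show "emeasure M B = (INF U\<in>{U. open U \<and> B \<subseteq> U}. emeasure M U)" (is "_ = ?I") if B: "B \<in> sets borel" for B
  proof (rule antisym)
    show "emeasure M B \<le> ?I" by (intro INF_greatest emeasure_mono) auto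
    show "?I \<le> emeasure M B"
    proof (rule ennreal_le_epsilon)
      fix e :: real assume "0 < e"
      with outer B obtain U where U: "open U" "B \<subseteq> U" "measure M (U - B) \<le> e" by blast
      have "?I \<le> emeasure M U" by (rule INF_lower) (use U in auto)
      also have "\<dots> \<le> emeasure M B + ennreal e" by (rule step) (use U B in auto)
      finally show "?I \<le> emeasure M B + ennreal e" .
    qed
  qed
  show "emeasure M U = (SUP K\<in>{K. compact K \<and> K \<subseteq> U}. emeasure M K)" (is "_ = ?S") if U: "open U" for U
  proof (rule antisym)
    show "?S \<le> emeasure M U" by (intro SUP_least emeasure_mono) (use U in auto)
    show "emeasure M U \<le> ?S"
    proof (rule ennreal_le_epsilon)
      fix e :: real assume e: "0 < e"
      have "- U \<in> sets borel" using U by auto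
      with outer e obtain V where V: "open V" "- U \<subseteq> V" "measure M (V - - U) \<le> e" by blast
      have "compact (- V)" using assms(1) V(1) by (metis compact_Int_closed closed_Compl inf_top_left)
      have "U - - V = V - - U" by auto
      then have "emeasure M U \<le> emeasure M (- V) + ennreal e" by (intro step) (use U V in auto)
      also have "\<dots> \<le> ?S + ennreal e"
        by (intro add_right_mono SUP_upper) (use V \<open>compact (- V)\<close> in auto)
      finally show "emeasure M U \<le> ?S + ennreal e" .
    qed
  qed
qed

definition birkhoff :: "('a \<Rightarrow> 'a) \<Rightarrow> nat \<Rightarrow> ('a \<Rightarrow> real) \<Rightarrow> 'a \<Rightarrow> real" where
  "birkhoff \<theta> N \<phi> x = (\<Sum>k<N. \<phi> ((\<theta> ^^ k) x)) / N"

locale uniquely_ergodic_system =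
  fixes \<theta> \<theta>' :: "'a::t2_space \<Rightarrow> 'a" and \<mu> :: "'a measure"
  assumes compact_UNIV: "compact (UNIV :: 'a set)"
    and hom: "homeomorphism UNIV UNIV \<theta> \<theta>'"
    and ue: "uniquely_ergodic_top \<theta>"
    and regular: "regular_borel_prob \<mu>"
    and invariant: "invariant_measure \<theta> \<mu>"
begin

sublocale prob_space \<mu>
  using regular by (simp add: regular_borel_prob_def)

lemma sets_mu[simp, measurable_cong]: "sets \<mu> = sets borel"
  using regular by (simp add: regular_borel_prob_def)

lemma space_mu[simp]: "space \<mu> = UNIV"
  using sets_eq_imp_space_eq[OF sets_mu] by simp

lemma unique: "regular_borel_prob M \<Longrightarrow> invariant_measure \<theta> M \<Longrightarrow> M = \<mu>"
  using ue regular invariant unfolding uniquely_ergodic_top_def by blast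

lemma continuous_theta: "continuous_on UNIV \<theta>"
  using hom by (simp add: homeomorphism_def)

lemma continuous_iterate: "continuous_on UNIV (\<theta> ^^ k)"
proof (induction k)
  case (Suc k)
  show ?case using continuous_on_compose2[OF continuous_theta Suc subset_UNIV] by (simp add: comp_def)
qed (simp add: id_def)

lemma continuous_iterate_compose[continuous_intros]:
  "continuous_on UNIV \<phi> \<Longrightarrow> continuous_on UNIV (\<lambda>x. \<phi> ((\<theta> ^^ k) x))"
  using continuous_on_compose2[OF _ continuous_iterate subset_UNIV] .

lemma measurable_theta[measurable]: "\<theta> \<in> measurable borel borel"
  using continuous_theta by (intro borel_measurable_continuous_onI)

lemma distr_theta: "distr \<mu> borel \<theta> = \<mu>"
proof (rule measure_eqI)
  fix A assume "A \<in> sets (distr \<mu> borel \<theta>)"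
  then show "emeasure (distr \<mu> borel \<theta>) A = emeasure \<mu> A"
    using invariant by (simp add: emeasure_distr invariant_measure_def)
qed simp

lemma AE_theta: "AE x in \<mu>. P x \<Longrightarrow> AE x in \<mu>. P (\<theta> x)"
proof -
  assume "AE x in \<mu>. P x"
  then have "AE x in distr \<mu> borel \<theta>. P x" by (simp only: distr_theta)
  then show ?thesis by (rule AE_distrD[rotated]) simp
qed

lemma integral_theta:
  fixes g :: "'a \<Rightarrow> 'b::{banach, second_countable_topology}"
  assumes [measurable]: "g \<in> borel_measurable borel"
  shows "(\<integral>x. g (\<theta> x) \<partial>\<mu>) = (\<integral>x. g x \<partial>\<mu>)"
  using integral_distr[of \<theta> \<mu> borel g] by (simp add: distr_theta)

lemmas bounded_continuous = continuous_norm_bound[OF compact_UNIV]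

lemma continuous_measurable: "continuous_on UNIV \<phi> \<Longrightarrow> \<phi> \<in> borel_measurable \<mu>"
  using borel_measurable_continuous_onI by (simp add: measurable_cong_sets[OF sets_mu refl])

lemma integrable_continuous:
  fixes \<phi> :: "'a \<Rightarrow> 'b::{banach, second_countable_topology}"
  assumes "continuous_on UNIV \<phi>"
  shows "integrable \<mu> \<phi>"
proof -
  obtain C where "\<And>x. norm (\<phi> x) \<le> C" using bounded_continuous[OF assms] by blast
  then show ?thesis
    using continuous_measurable[OF assms] by (intro integrable_const_bound[of _ C]) auto
qed

section \<open>Uniform convergence of unweighted averages under unique ergodicity\<close>

lemma birkhoff_shift:
  assumes "\<And>x. \<bar>\<phi> x\<bar> \<le> C"
  shows "\<bar>birkhoff \<theta> N (\<lambda>x. \<phi> (\<theta> x)) x - birkhoff \<theta> N \<phi> x\<bar> \<le> 2 * C / N"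
proof -
  have "(\<Sum>k<N. \<phi> (\<theta> ((\<theta> ^^ k) x))) - (\<Sum>k<N. \<phi> ((\<theta> ^^ k) x)) = \<phi> ((\<theta> ^^ N) x) - \<phi> x"
    by (induction N) auto
  then have "birkhoff \<theta> N (\<lambda>x. \<phi> (\<theta> x)) x - birkhoff \<theta> N \<phi> x = (\<phi> ((\<theta> ^^ N) x) - \<phi> x) / N"
    by (simp add: birkhoff_def flip: diff_divide_distrib)
  moreover have "\<bar>\<phi> ((\<theta> ^^ N) x) - \<phi> x\<bar> \<le> 2 * C" using assms[of x] assms[of "(\<theta> ^^ N) x"] by linarith
  ultimately show ?thesis by (simp add: divide_right_mono)
qed

lemma birkhoff_bound:
  assumes "\<And>x. \<bar>\<phi> x\<bar> \<le> C"
  shows "\<bar>birkhoff \<theta> N \<phi> x\<bar> \<le> C"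
proof (cases "N = 0")
  case True
  then show ?thesis using assms[of x] by (simp add: birkhoff_def)
next
  case False
  have "\<bar>\<Sum>k<N. \<phi> ((\<theta> ^^ k) x)\<bar> \<le> (\<Sum>k<N. C)" by (rule sum_abs[THEN order_trans]) (intro sum_mono assms)
  then show ?thesis using False by (simp add: birkhoff_def field_simps)
qed

text \<open>A failure of uniform convergence would produce, as a cluster point of averages along orbit
  pieces in the product topology, an invariant functional that differs from \<open>\<mu>\<close>.\<close>
theorem birkhoff_uniform_limit:
  assumes c: "continuous_on UNIV \<phi>"
  shows "uniform_limit UNIV (\<lambda>N. birkhoff \<theta> N \<phi>) (\<lambda>_. \<integral>x. \<phi> x \<partial>\<mu>) sequentially"
proof (rule ccontr)
  assume "\<not> ?thesis"
  then obtain e :: real where e: "0 < e" "\<forall>n. \<exists>N\<ge>n. \<exists>x. e \<le> \<bar>birkhoff \<theta> N \<phi> x - (\<integral>x. \<phi> x \<partial>\<mu>)\<bar>"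
    unfolding uniform_limit_sequentially_iff by (auto simp: dist_real_def not_less)
  \<comment> \<open>The bound \<open>Suc j \<le> N\<close> keeps the orbit pieces nonempty, so that
    the constant 1 has average 1, and makes their lengths tend to infinity, which yields invariance
    of the limit.\<close>
  then have "\<forall>j. \<exists>N x. Suc j \<le> N \<and> e \<le> \<bar>birkhoff \<theta> N \<phi> x - (\<integral>x. \<phi> x \<partial>\<mu>)\<bar>" by blast
  then obtain N X where N: "\<And>j. Suc j \<le> N j"
    and X: "\<And>j. e \<le> \<bar>birkhoff \<theta> (N j) \<phi> (X j) - (\<integral>x. \<phi> x \<partial>\<mu>)\<bar>" by metis
  \<comment> \<open>The value 0 on discontinuous functions keeps every coordinate bounded, so all
    \<open>l j\<close> lie in the single product \<open>K\<close> of compact intervals, compact by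
    Tychonoff.\<close>
  define l where "l j \<psi> = (if continuous_on UNIV \<psi> then birkhoff \<theta> (N j) \<psi> (X j) else 0)" for j \<psi>
  have "\<exists>C. 0 \<le> C \<and> (continuous_on UNIV \<psi> \<longrightarrow> (\<forall>x. \<bar>\<psi> x\<bar> \<le> C))" for \<psi> :: "'a \<Rightarrow> real"
  proof (cases "continuous_on UNIV \<psi>")
    case True
    then obtain C where "0 < C" "\<And>x. norm (\<psi> x) \<le> C" using bounded_continuous[OF True] by blast
    then have "0 \<le> C \<and> (\<forall>x. \<bar>\<psi> x\<bar> \<le> C)" by simp
    then show ?thesis by blast
  qed auto
  then have "\<forall>\<psi> :: 'a \<Rightarrow> real. \<exists>C. 0 \<le> C \<and> (continuous_on UNIV \<psi> \<longrightarrow> (\<forall>x. \<bar>\<psi> x\<bar> \<le> C))" by (rule allI)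
  from choice[OF this] obtain C :: "('a \<Rightarrow> real) \<Rightarrow> real"
    where C': "\<forall>\<psi>. 0 \<le> C \<psi> \<and> (continuous_on UNIV \<psi> \<longrightarrow> (\<forall>x. \<bar>\<psi> x\<bar> \<le> C \<psi>))" ..
  have C: "0 \<le> C \<psi>" "continuous_on UNIV \<psi> \<Longrightarrow> \<bar>\<psi> x\<bar> \<le> C \<psi>" for \<psi> x
    using spec[OF C', of \<psi>] by auto
  define K where "K = (\<Pi>\<^sub>E \<psi>\<in>UNIV. {- C \<psi>..C \<psi>})"
  have "compact K"
    unfolding K_def compactin_euclidean_iff[symmetric] euclidean_product_topology[symmetric]
    by (simp add: compactin_PiE)
  moreover have lK: "l j \<in> K" for j
  proof -
    have "\<bar>l j \<psi>\<bar> \<le> C \<psi>" for \<psi> using C birkhoff_bound[of \<psi> "C \<psi>"] by (auto simp: l_def)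
    then show ?thesis unfolding K_def PiE_UNIV_domain by (simp add: abs_le_iff Pi_def minus_le_iff)
  qed
  ultimately obtain L where L: "inf (nhds L) (filtermap l sequentially) \<noteq> bot"
    using compact_filter[THEN iffD1, rule_format, of K "filtermap l sequentially"]
    by (metis always_eventually eventually_filtermap filtermap_bot_iff trivial_limit_sequentially)
  \<comment> \<open>The product has a coordinate for each function, so subsequences may fail to
    converge. \<open>H\<close> plays the role of a convergent subnet: it refines the tail filter of
    \<open>l\<close> and converges to \<open>L\<close>.\<close>
  define H where "H = inf (nhds L) (filtermap l sequentially)"
  have Hb: "H \<noteq> bot" using L by (simp add: H_def)
  have lim: "((\<lambda>L'. L' \<psi>) \<longlongrightarrow> L \<psi>) H" for \<psi>
  proof -
    have "((\<lambda>L'. L') \<longlongrightarrow> L) H" by (simp add: filterlim_def H_def)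
    then show ?thesis
      using continuous_on_tendsto_compose[OF continuous_on_product_coordinates[of \<psi>] \<open>((\<lambda>L'. L') \<longlongrightarrow> L) H\<close>]
      by simp
  qed
  have ev: "eventually P H" if "\<And>j. P (l j)" for P
    unfolding H_def by (rule filter_leD[OF inf_le2]) (simp add: eventually_filtermap that)
  \<comment> \<open>Transfer principle: a quantity that converges along the sequence
    \<open>l\<close> has the same limit along \<open>H\<close>. Linearity, normalisation and
    invariance of \<open>L\<close> are all read off in this way.\<close>
  have key: "a = b" if "(g \<longlongrightarrow> a) H" "(\<lambda>j. g (l j)) \<longlonglongrightarrow> b" for g and a b :: real
  proof (rule tendsto_unique[OF Hb that(1)])
    have "(g \<longlongrightarrow> b) (filtermap l sequentially)" using that(2) by (simp add: filterlim_def filtermap_filtermap)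
    then show "(g \<longlongrightarrow> b) H" by (rule tendsto_mono[rotated]) (simp add: H_def)
  qed
  interpret L: positive_functional L
  proof
    show "compact (UNIV :: 'a set)" by (rule compact_UNIV)
  next
    fix \<phi> \<psi> :: "'a \<Rightarrow> real" assume c: "continuous_on UNIV \<phi>" "continuous_on UNIV \<psi>"
    have "l j (\<lambda>x. \<phi> x + \<psi> x) - (l j \<phi> + l j \<psi>) = 0" for j
      using c by (simp add: l_def continuous_on_add birkhoff_def sum.distrib add_divide_distrib)
    then have "L (\<lambda>x. \<phi> x + \<psi> x) - (L \<phi> + L \<psi>) = 0"
      by (intro key[of "\<lambda>L'. L' (\<lambda>x. \<phi> x + \<psi> x) - (L' \<phi> + L' \<psi>)"]) (auto intro!: tendsto_intros lim)
    then show "L (\<lambda>x. \<phi> x + \<psi> x) = L \<phi> + L \<psi>" by simp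
  next
    fix \<phi> :: "'a \<Rightarrow> real" and a assume c: "continuous_on UNIV \<phi>"
    have "l j (\<lambda>x. a * \<phi> x) - a * l j \<phi> = 0" for j
      using c by (simp add: l_def continuous_on_mult_left birkhoff_def sum_distrib_left)
    then have "L (\<lambda>x. a * \<phi> x) - a * L \<phi> = 0"
      by (intro key[of "\<lambda>L'. L' (\<lambda>x. a * \<phi> x) - a * L' \<phi>"]) (auto intro!: tendsto_intros lim)
    then show "L (\<lambda>x. a * \<phi> x) = a * L \<phi>" by simp
  next
    fix \<phi> :: "'a \<Rightarrow> real" assume nn: "\<And>x. 0 \<le> \<phi> x"
    show "0 \<le> L \<phi>"
      by (rule tendsto_lowerbound[OF lim ev Hb]) (auto simp: l_def birkhoff_def intro!: divide_nonneg_nonneg sum_nonneg nn)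
  next
    have "l j (\<lambda>_. 1) = 1" for j using N[of j] by (simp add: l_def birkhoff_def)
    then show "L (\<lambda>_. 1) = 1" by (intro key[OF lim]) simp
  qed
  have inv: "L (\<lambda>x. \<psi> (\<theta> x)) = L \<psi>" if c: "continuous_on UNIV \<psi>" for \<psi>
  proof -
    have c': "continuous_on UNIV (\<lambda>x. \<psi> (\<theta> x))" by (rule continuous_on_compose2[OF c continuous_theta]) simp
    have "(\<lambda>j. l j (\<lambda>x. \<psi> (\<theta> x)) - l j \<psi>) \<longlonglongrightarrow> 0"
    proof (rule Lim_null_comparison)
      have "norm (l j (\<lambda>x. \<psi> (\<theta> x)) - l j \<psi>) \<le> 2 * C \<psi> / Suc j" for j
      proof -
        have "norm (l j (\<lambda>x. \<psi> (\<theta> x)) - l j \<psi>) \<le> 2 * C \<psi> / N j"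
          using birkhoff_shift[OF C(2)[OF c]] c c' by (simp add: l_def)
        also have "\<dots> \<le> 2 * C \<psi> / Suc j" using N[of j] C(1)[of \<psi>] by (intro divide_left_mono) auto
        finally show ?thesis .
      qed
      then show "\<forall>\<^sub>F j in sequentially. norm (l j (\<lambda>x. \<psi> (\<theta> x)) - l j \<psi>) \<le> 2 * C \<psi> / Suc j" by simp
      show "(\<lambda>j. 2 * C \<psi> / Suc j) \<longlonglongrightarrow> 0" by (rule LIMSEQ_Suc) (rule lim_const_over_n)
    qed
    then have "L (\<lambda>x. \<psi> (\<theta> x)) - L \<psi> = 0"
      by (intro key[of "\<lambda>L'. L' (\<lambda>x. \<psi> (\<theta> x)) - L' \<psi>"]) (auto intro!: tendsto_intros lim)
    then show ?thesis by simp
  qed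
  have "L.rmeasure = \<mu>"
    by (intro unique L.regular_rmeasure L.invariant_rmeasure[OF hom] inv)
  then have "L \<phi> = (\<integral>x. \<phi> x \<partial>\<mu>)" using L.riesz_markov[OF c] by simp
  moreover have "e \<le> \<bar>L \<phi> - (\<integral>x. \<phi> x \<partial>\<mu>)\<bar>"
    by (rule tendsto_lowerbound[OF tendsto_rabs[OF tendsto_diff[OF lim tendsto_const]] ev Hb])
      (use X c in \<open>simp add: l_def\<close>)
  ultimately show False using e(1) by simp
qed

section \<open>Ergodicity: bounded invariant functions are almost everywhere constant\<close>

lemma invariant_density:
  fixes w :: "'a \<Rightarrow> real"
  assumes [measurable]: "w \<in> borel_measurable borel" and inv: "AE x in \<mu>. w (\<theta> x) = w x"
  shows "invariant_measure \<theta> (density \<mu> (\<lambda>x. ennreal (w x)))"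
  unfolding invariant_measure_def
proof
  fix B assume "B \<in> sets (density \<mu> (\<lambda>x. ennreal (w x)))"
  then have [measurable]: "B \<in> sets borel" by simp
  have vB: "\<theta> -` B \<in> sets borel" using measurable_sets[of \<theta> borel borel B] by simp
  have "emeasure (density \<mu> w) (\<theta> -` B) = (\<integral>\<^sup>+x. ennreal (w x) * indicator (\<theta> -` B) x \<partial>\<mu>)"
    using vB by (intro emeasure_density) auto
  also have "\<dots> = (\<integral>\<^sup>+x. ennreal (w (\<theta> x)) * indicator B (\<theta> x) \<partial>\<mu>)"
    by (rule nn_integral_cong_AE) (use inv in \<open>auto simp: indicator_def\<close>)
  also have "\<dots> = (\<integral>\<^sup>+x. ennreal (w x) * indicator B x \<partial>distr \<mu> borel \<theta>)"
    by (subst nn_integral_distr) auto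
  also have "\<dots> = emeasure (density \<mu> w) B"
    unfolding distr_theta by (intro emeasure_density[symmetric]) auto
  finally show "emeasure (density \<mu> w) (\<theta> -` B \<inter> space (density \<mu> w)) = emeasure (density \<mu> w) B" by simp
qed

text \<open>Otherwise a normalised density \<open>w\<close> would give a second invariant regular measure.\<close>
lemma invariant_density_const:
  fixes w :: "'a \<Rightarrow> real"
  assumes w[measurable]: "w \<in> borel_measurable borel" and inv: "AE x in \<mu>. w (\<theta> x) = w x"
    and nn: "\<And>x. 0 \<le> w x" and D: "\<And>x. w x \<le> D" and int1: "(\<integral>x. w x \<partial>\<mu>) = 1"
  shows "AE x in \<mu>. w x = 1"
proof -
  let ?M = "density \<mu> (\<lambda>x. ennreal (w x))"
  have iw: "integrable \<mu> w" using nn D by (intro integrable_const_bound[of _ D]) (auto simp: abs_le_iff)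
  have "(\<integral>\<^sup>+x. ennreal (w x) \<partial>\<mu>) = 1" using nn_integral_eq_integral[OF iw] nn int1 by simp
  then have prob: "prob_space ?M" by (intro prob_spaceI) (simp add: emeasure_density)
  have D0: "0 \<le> D" using nn[of undefined] D[of undefined] by linarith
  have reg: "regular_borel_prob ?M"
  proof (rule regular_borel_probI[OF compact_UNIV prob])
    show "sets ?M = sets borel" by simp
    fix B :: "'a set" and e :: real assume B: "B \<in> sets borel" and e: "0 < e"
    \<comment> \<open>A density bounded by \<open>D\<close> enlarges the excess \<open>U - B\<close>
      at most by the factor \<open>D\<close>, so regularity is inherited from \<open>\<mu>\<close>.
      The divisor \<open>D + 1\<close> is positive even when \<open>D = 0\<close>.\<close>
    have "0 < e / (D + 1)" using e D0 by simp
    from regular_outer[OF regular B this]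
    obtain U where U: "open U" "B \<subseteq> U" "measure \<mu> (U - B) < e / (D + 1)" .
    have UB[measurable]: "U - B \<in> sets borel" using U B by auto
    have "emeasure ?M (U - B) = (\<integral>\<^sup>+x. ennreal (w x) * indicator (U - B) x \<partial>\<mu>)"
      by (intro emeasure_density) auto
    also have "\<dots> \<le> (\<integral>\<^sup>+x. ennreal D * indicator (U - B) x \<partial>\<mu>)"
      by (intro nn_integral_mono mult_right_mono ennreal_leI D) auto
    also have "\<dots> = ennreal (D * measure \<mu> (U - B))"
      using D0 by (simp add: nn_integral_cmult emeasure_eq_measure ennreal_mult)
    finally have "measure ?M (U - B) \<le> D * measure \<mu> (U - B)"
      using D0 by (simp add: measure_def enn2real_leI)
    also have "\<dots> \<le> (D + 1) * measure \<mu> (U - B)" by (simp add: mult_right_mono)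
    also have "\<dots> \<le> e" using U(3) D0 by (simp add: field_simps)
    finally show "\<exists>U. open U \<and> B \<subseteq> U \<and> measure ?M (U - B) \<le> e" using U by blast
  qed
  have "?M = \<mu>" by (rule unique[OF reg invariant_density[OF w inv]])
  also have "\<mu> = density \<mu> (\<lambda>_. 1)" by (simp add: density_1)
  finally have "AE x in \<mu>. ennreal (w x) = 1" by (subst (asm) density_unique_iff) auto
  then show ?thesis using nn by (auto simp: ennreal_eq_1)
qed

theorem ergodic_real:
  fixes g :: "'a \<Rightarrow> real"
  assumes [measurable]: "g \<in> borel_measurable borel" and inv: "AE x in \<mu>. g (\<theta> x) = g x"
    and bd: "AE x in \<mu>. \<bar>g x\<bar> \<le> C"
  obtains c where "AE x in \<mu>. g x = c"
proof -
  \<comment> \<open>Shifting by \<open>\<bar>C\<bar> + 1\<close> and clipping makes the bounds hold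
    everywhere instead of almost everywhere and keeps \<open>h\<close> at least 1, so the
    normalising integral \<open>I\<close> is positive. Almost everywhere the clipping does nothing,
    so undoing the shift recovers \<open>g\<close>.\<close>
  define h where "h x = max 1 (min (2 * \<bar>C\<bar> + 1) (g x + \<bar>C\<bar> + 1))" for x
  have h: "1 \<le> h x" "h x \<le> 2 * \<bar>C\<bar> + 1" for x by (auto simp: h_def)
  have [measurable]: "h \<in> borel_measurable borel" unfolding h_def by measurable
  define I where "I = (\<integral>x. h x \<partial>\<mu>)"
  have "\<bar>h x\<bar> \<le> 2 * \<bar>C\<bar> + 1" for x using h[of x] by linarith
  then have ih: "integrable \<mu> h" by (intro integrable_const_bound[of _ "2 * \<bar>C\<bar> + 1"]) auto
  have "(\<integral>x. 1 \<partial>\<mu>) \<le> I" unfolding I_def by (intro integral_mono ih h) simp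
  then have I: "1 \<le> I" using prob_space by simp
  have "AE x in \<mu>. h x / I = 1"
  proof (rule invariant_density_const[of _ "(2 * \<bar>C\<bar> + 1) / I"])
    show "AE x in \<mu>. h (\<theta> x) / I = h x / I" using inv by eventually_elim (simp add: h_def)
    show "0 \<le> h x / I" for x using h(1)[of x] I by simp
    show "h x / I \<le> (2 * \<bar>C\<bar> + 1) / I" for x using h(2)[of x] I by (simp add: divide_right_mono)
    show "(\<integral>x. h x / I \<partial>\<mu>) = 1" using I by (simp add: I_def[symmetric])
  qed measurable
  with bd have "AE x in \<mu>. g x = I - \<bar>C\<bar> - 1"
    by eventually_elim (use I in \<open>auto simp: h_def max_def min_def split: if_splits\<close>)
  then show ?thesis using that by blast
qed

theorem ergodic_complex:
  fixes g :: "'a \<Rightarrow> complex"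
  assumes [measurable]: "g \<in> borel_measurable borel" and inv: "AE x in \<mu>. g (\<theta> x) = g x"
    and bd: "AE x in \<mu>. cmod (g x) \<le> C"
  obtains c where "AE x in \<mu>. g x = c"
proof -
  have "AE x in \<mu>. \<bar>Re (g x)\<bar> \<le> C" using bd by eventually_elim (rule order_trans[OF abs_Re_le_cmod])
  moreover have "AE x in \<mu>. Re (g (\<theta> x)) = Re (g x)" using inv by eventually_elim simp
  ultimately obtain a where a: "AE x in \<mu>. Re (g x) = a" using ergodic_real[of "\<lambda>x. Re (g x)"] by auto
  have "AE x in \<mu>. \<bar>Im (g x)\<bar> \<le> C" using bd by eventually_elim (rule order_trans[OF abs_Im_le_cmod])
  moreover have "AE x in \<mu>. Im (g (\<theta> x)) = Im (g x)" using inv by eventually_elim simp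
  ultimately obtain b where b: "AE x in \<mu>. Im (g x) = b" using ergodic_real[of "\<lambda>x. Im (g x)"] by auto
  from a b have "AE x in \<mu>. g x = Complex a b" by eventually_elim (simp add: complex_eq_iff)
  then show ?thesis using that by blast
qed

end

section \<open>Weighted ergodic averages\<close>

definition cocycle :: "('a \<Rightarrow> 'a) \<Rightarrow> ('a \<Rightarrow> complex) \<Rightarrow> nat \<Rightarrow> 'a \<Rightarrow> complex" where
  "cocycle \<theta> u k x = (\<Prod>j<k. u ((\<theta> ^^ j) x))"

text \<open>The closed form of the \<open>k\<close>-th iterate of the weighted Koopman operator
  sending \<open>F\<close> to \<open>u * (F \<circ> \<theta>)\<close>; \<open>W_Suc\<close> and
  \<open>W_add\<close> confirm this.\<close>

definition wpow :: "('a \<Rightarrow> 'a) \<Rightarrow> ('a \<Rightarrow> complex) \<Rightarrow> nat \<Rightarrow> ('a \<Rightarrow> complex) \<Rightarrow> 'a \<Rightarrow> complex" where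
  "wpow \<theta> u k F x = cocycle \<theta> u k x * F ((\<theta> ^^ k) x)"

definition cesaro :: "('a \<Rightarrow> 'a) \<Rightarrow> ('a \<Rightarrow> complex) \<Rightarrow> nat \<Rightarrow> ('a \<Rightarrow> complex) \<Rightarrow> 'a \<Rightarrow> complex" where
  "cesaro \<theta> u N F x = (\<Sum>k<N. wpow \<theta> u k F x) / of_nat N"

lemma norm_average_square_le:
  fixes z :: "nat \<Rightarrow> complex"
  shows "(cmod ((\<Sum>k<N. z k) / of_nat N))\<^sup>2 \<le> (\<Sum>k<N. (cmod (z k))\<^sup>2) / N"
proof (cases "N = 0")
  case False
  have "(cmod (\<Sum>k<N. z k))\<^sup>2 \<le> (\<Sum>k<N. cmod (z k))\<^sup>2"
    by (intro power_mono norm_sum) auto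
  also have "\<dots> \<le> (\<Sum>k<N. (cmod (z k))\<^sup>2) * N"
    using sum_squared_le_sum_of_squares[where I = "{..<N}" and f = "\<lambda>k. cmod (z k)"] by simp
  finally show ?thesis using False by (simp add: norm_divide power_divide field_simps power2_eq_square)
qed simp

lemma norm_square_diff_le:
  fixes a b :: complex
  assumes "cmod a \<le> C" "cmod b \<le> C" "cmod (a - b) \<le> r"
  shows "(cmod a)\<^sup>2 \<le> (cmod b)\<^sup>2 + 2 * C * r"
proof -
  have C: "0 \<le> C" using assms(1) norm_ge_zero order_trans by blast
  have "cmod a - cmod b \<le> r" using norm_triangle_ineq2[of a b] assms(3) by linarith
  moreover have r: "0 \<le> r" using assms(3) norm_ge_zero order_trans by blast
  ultimately have "(cmod a + cmod b) * (cmod a - cmod b) \<le> (cmod a + cmod b) * r"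
    by (intro mult_left_mono) auto
  also have "\<dots> \<le> (2 * C) * r" using assms r by (intro mult_right_mono) auto
  finally show ?thesis by (simp add: algebra_simps power2_eq_square)
qed

context prob_space
begin

lemma integral_square_le:
  fixes h :: "'a \<Rightarrow> real"
  assumes "integrable M h" "integrable M (\<lambda>x. (h x)\<^sup>2)"
  shows "(\<integral>x. h x \<partial>M)\<^sup>2 \<le> (\<integral>x. (h x)\<^sup>2 \<partial>M)"
  using variance_eq[OF assms] variance_positive[of h] by simp

end

text \<open>\<open>u\<close> will be \<open>\<lambda>x. f x powi n\<close>, one weight for each
  Fourier mode \<open>n\<close> of the circle variable. Unit modulus makes the iterates act on
  moduli as plain composition with \<open>\<theta>\<close>.\<close>

locale weighted_system = uniquely_ergodic_system \<theta> \<theta>' \<mu>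
  for \<theta> \<theta>' :: "'a::t2_space \<Rightarrow> 'a" and \<mu> +
  fixes u :: "'a \<Rightarrow> complex"
  assumes continuous_u[continuous_intros]: "continuous_on UNIV u"
    and norm_u: "cmod (u x) = 1"
begin

abbreviation "W \<equiv> wpow \<theta> u"
abbreviation "A \<equiv> cesaro \<theta> u"

lemma norm_cocycle: "cmod (cocycle \<theta> u k x) = 1"
  by (simp add: cocycle_def norm_u flip: prod_norm)

lemma norm_W: "cmod (W k F x) = cmod (F ((\<theta> ^^ k) x))"
  by (simp add: wpow_def norm_mult norm_cocycle)

lemma W_Suc: "W (Suc k) F x = u x * W k F (\<theta> x)"
  by (simp add: wpow_def cocycle_def prod.lessThan_Suc_shift funpow_swap1 del: funpow.simps prod.lessThan_Suc)
     (simp add: funpow_swap1)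

lemma W_0[simp]: "W 0 F x = F x"
  by (simp add: wpow_def cocycle_def)

lemma W_add: "W k (W m F) x = W (k + m) F x"
  by (induction k arbitrary: x) (simp_all add: W_Suc)

lemma W_diff: "W k (\<lambda>x. F x - G x) x = W k F x - W k G x"
  by (simp add: wpow_def algebra_simps)

lemma A_diff: "A N (\<lambda>x. F x - G x) x = A N F x - A N G x"
  by (simp add: cesaro_def W_diff sum_subtractf diff_divide_distrib)

lemma A_half_add: "A N (\<lambda>x. (F x + G x) / 2) x = (A N F x + A N G x) / 2"
  by (simp add: cesaro_def wpow_def algebra_simps sum.distrib add_divide_distrib flip: sum_divide_distrib)

lemma continuous_W[continuous_intros]:
  assumes [continuous_intros]: "continuous_on UNIV F"
  shows "continuous_on UNIV (W k F)"
  unfolding wpow_def[abs_def] cocycle_def by (intro continuous_intros)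

lemma continuous_A[continuous_intros]:
  assumes [continuous_intros]: "continuous_on UNIV F"
  shows "continuous_on UNIV (A N F)"
  unfolding cesaro_def[abs_def] divide_inverse by (intro continuous_intros)

lemma norm_A_le_birkhoff: "cmod (A N F x) \<le> birkhoff \<theta> N (\<lambda>x. cmod (F x)) x"
proof -
  have "cmod (\<Sum>k<N. W k F x) \<le> (\<Sum>k<N. cmod (F ((\<theta> ^^ k) x)))"
    using norm_sum[of "\<lambda>k. W k F x" "{..<N}"] by (simp add: norm_W)
  then show ?thesis by (simp add: cesaro_def birkhoff_def norm_divide divide_right_mono)
qed

lemma norm_A_le:
  assumes "\<And>x. cmod (F x) \<le> C"
  shows "cmod (A N F x) \<le> C"
  using norm_A_le_birkhoff[of N F x] birkhoff_bound[of "\<lambda>x. cmod (F x)" C N x] assms by simp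

lemma norm_A_square_le: "(cmod (A N F x))\<^sup>2 \<le> birkhoff \<theta> N (\<lambda>x. (cmod (F x))\<^sup>2) x"
  using norm_average_square_le[of "\<lambda>k. W k F x" N] by (simp add: cesaro_def birkhoff_def norm_W)

lemma W_fixed:
  assumes "\<And>x. G (\<theta> x) * u x = G x"
  shows "W k G x = G x"
proof (induction k arbitrary: x)
  case (Suc k)
  then show ?case using assms[of x] by (simp add: W_Suc mult.commute)
qed simp

lemma A_fixed:
  assumes "\<And>x. G (\<theta> x) * u x = G x" "0 < N"
  shows "A N G x = G x"
  using assms(2) by (simp add: cesaro_def W_fixed[OF assms(1)])

lemma AE_W_fixed:
  assumes "AE x in \<mu>. g (\<theta> x) * u x = g x"
  shows "AE x in \<mu>. W k g x = g x"
proof (induction k)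
  case (Suc k)
  from AE_theta[OF Suc] assms show ?case
    by eventually_elim (simp add: W_Suc mult.commute)
qed simp

lemma AE_A_fixed:
  assumes "AE x in \<mu>. g (\<theta> x) * u x = g x" "0 < N"
  shows "AE x in \<mu>. A N g x = g x"
proof -
  have "AE x in \<mu>. \<forall>k. W k g x = g x" using AE_W_fixed[OF assms(1)] by (simp add: AE_all_countable)
  then show ?thesis by eventually_elim (use assms(2) in \<open>simp add: cesaro_def\<close>)
qed

lemma A_W1_diff: "A N (W 1 F) x - A N F x = (W N F x - F x) / of_nat N"
proof -
  have "(\<Sum>k<N. W k (W 1 F) x) - (\<Sum>k<N. W k F x) = W N F x - F x"
    unfolding W_add by (induction N) (auto simp: algebra_simps)
  then show ?thesis by (simp add: cesaro_def flip: diff_divide_distrib)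
qed

lemma norm_A_W1_diff:
  assumes "\<And>x. cmod (F x) \<le> C"
  shows "cmod (A N (W 1 F) x - A N F x) \<le> 2 * C / N"
proof -
  have "cmod (W N F x - F x) \<le> 2 * C"
    using norm_triangle_ineq4[of "W N F x" "F x"] assms[of x] assms[of "(\<theta> ^^ N) x"] by (simp add: norm_W)
  then show ?thesis unfolding A_W1_diff norm_divide by (simp add: divide_right_mono)
qed

lemma A_equivariant: "u x * A N F (\<theta> x) = A N (W 1 F) x"
  unfolding cesaro_def W_add by (simp add: sum_distrib_left W_Suc)

lemma norm_A_W_diff:
  assumes "\<And>x. cmod (F x) \<le> C"
  shows "cmod (A N (W m F) x - A N F x) \<le> m * (2 * C / N)"
proof (induction m)
  case (Suc m)
  have "W (Suc m) F = W 1 (W m F)" by (rule ext) (simp add: W_add)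
  then have "cmod (A N (W (Suc m) F) x - A N (W m F) x) \<le> 2 * C / N"
    using norm_A_W1_diff[where F = "W m F" and C = C] assms by (simp add: norm_W)
  then have "cmod (A N (W (Suc m) F) x - A N F x) \<le> 2 * C / N + m * (2 * C / N)"
    by (rule norm_diff_triangle_le[OF _ Suc])
  then show ?case by (simp only: of_nat_Suc distrib_right mult_1)
qed simp

text \<open>\<open>A N (A M F)\<close> is the mean over \<open>m < M\<close> of
  \<open>A N (W m F)\<close>. Each single shift changes an average of length \<open>N\<close> only
  by two boundary terms, at most \<open>2 * C / N\<close>, and \<open>m < M\<close> shifts are made.
  So for \<open>N\<close> large compared with \<open>M\<close>, averaging twice is averaging
  once.\<close>

lemma norm_A_A_diff:
  assumes F: "\<And>x. cmod (F x) \<le> C" and M: "0 < M"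
  shows "cmod (A N (A M F) x - A N F x) \<le> M * (2 * C / N)"
proof -
  have C: "0 \<le> C" using F norm_ge_zero order_trans by blast
  have "A N (A M F) x = (\<Sum>m<M. A N (W m F) x) / of_nat M"
  proof -
    have "W k (A M F) x = (\<Sum>m<M. W (k + m) F x) / of_nat M" for k
      unfolding W_add[symmetric] by (simp add: wpow_def[of _ _ k] cesaro_def sum_distrib_left)
    then have "A N (A M F) x = (\<Sum>k<N. \<Sum>m<M. W (k + m) F x) / of_nat M / of_nat N"
      by (simp add: cesaro_def[of _ _ N] sum_divide_distrib)
    also have "\<dots> = (\<Sum>m<M. \<Sum>k<N. W (k + m) F x) / of_nat N / of_nat M"
      by (subst sum.swap) simp
    finally show ?thesis by (simp add: cesaro_def W_add sum_divide_distrib)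
  qed
  then have eq: "A N (A M F) x - A N F x = (\<Sum>m<M. A N (W m F) x - A N F x) / of_nat M"
    using M by (simp add: sum_subtractf diff_divide_distrib)
  have "cmod (\<Sum>m<M. A N (W m F) x - A N F x) \<le> (\<Sum>m<M. M * (2 * C / N))"
  proof (rule order_trans[OF norm_sum sum_mono])
    fix m assume "m \<in> {..<M}"
    then have "m * (2 * C / N) \<le> M * (2 * C / N)" using C by (intro mult_right_mono) auto
    with norm_A_W_diff[where F = F, OF F, where N = N and m = m and x = x] show "cmod (A N (W m F) x - A N F x) \<le> M * (2 * C / N)" by linarith
  qed
  then have "cmod (\<Sum>m<M. A N (W m F) x - A N F x) / M \<le> M * (M * (2 * C / N)) / M"
    by (intro divide_right_mono) simp_all
  also have "M * (M * (2 * C / N)) / M = M * (2 * C / N)" using M by simp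
  finally show ?thesis unfolding eq by (simp only: norm_divide norm_of_nat)
qed

lemma integrable_theta:
  fixes \<phi> :: "'a \<Rightarrow> real"
  assumes "integrable \<mu> \<phi>"
  shows "integrable \<mu> (\<lambda>x. \<phi> (\<theta> x))" "(\<integral>x. \<phi> (\<theta> x) \<partial>\<mu>) = (\<integral>x. \<phi> x \<partial>\<mu>)"
proof -
  have m: "\<phi> \<in> borel_measurable borel" using borel_measurable_integrable[OF assms] by simp
  show "integrable \<mu> (\<lambda>x. \<phi> (\<theta> x))"
    using integrable_distr_eq[of \<theta> \<mu> borel \<phi>] m assms by (simp add: distr_theta)
  show "(\<integral>x. \<phi> (\<theta> x) \<partial>\<mu>) = (\<integral>x. \<phi> x \<partial>\<mu>)" by (rule integral_theta[OF m])
qed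

lemma integral_iterate:
  fixes \<phi> :: "'a \<Rightarrow> real"
  assumes "integrable \<mu> \<phi>"
  shows "integrable \<mu> (\<lambda>x. \<phi> ((\<theta> ^^ k) x)) \<and> (\<integral>x. \<phi> ((\<theta> ^^ k) x) \<partial>\<mu>) = (\<integral>x. \<phi> x \<partial>\<mu>)"
proof (induction k)
  case (Suc k)
  have "(\<lambda>x. \<phi> ((\<theta> ^^ Suc k) x)) = (\<lambda>x. \<phi> ((\<theta> ^^ k) (\<theta> x)))" by (simp add: funpow_swap1)
  then show ?case using Suc integrable_theta[of "\<lambda>x. \<phi> ((\<theta> ^^ k) x)"] by simp
qed (use assms in simp)

lemma integral_birkhoff:
  assumes "integrable \<mu> \<phi>" "0 < N"
  shows "integrable \<mu> (birkhoff \<theta> N \<phi>)" "(\<integral>x. birkhoff \<theta> N \<phi> x \<partial>\<mu>) = (\<integral>x. \<phi> x \<partial>\<mu>)"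
  using assms(2) integral_iterate[OF assms(1)] unfolding birkhoff_def[abs_def] by simp_all

section \<open>The mean ergodic theorem by minimising the squared \<open>L^2\<close> norm over
  averages\<close>

definition energy :: "('a \<Rightarrow> complex) \<Rightarrow> real" where
  "energy h = (\<integral>x. (cmod (h x))\<^sup>2 \<partial>\<mu>)"

lemma energy_integrable:
  assumes "continuous_on UNIV h"
  shows "integrable \<mu> (\<lambda>x. (cmod (h x))\<^sup>2)"
  by (intro integrable_continuous continuous_intros assms)

lemma energy_nonneg: "0 \<le> energy h"
  by (simp add: energy_def)

lemma energy_A_le:
  assumes "continuous_on UNIV h" "0 < N"
  shows "energy (A N h) \<le> energy h"
proof -
  have "energy (A N h) \<le> (\<integral>x. birkhoff \<theta> N (\<lambda>x. (cmod (h x))\<^sup>2) x \<partial>\<mu>)"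
    unfolding energy_def
    by (intro integral_mono energy_integrable continuous_A assms norm_A_square_le integral_birkhoff)
  also have "\<dots> = energy h" unfolding energy_def by (intro integral_birkhoff energy_integrable assms)
  finally show ?thesis .
qed

lemma energy_perturb:
  assumes c: "continuous_on UNIV a" "continuous_on UNIV b"
    and "\<And>x. cmod (a x) \<le> C" "\<And>x. cmod (b x) \<le> C" "\<And>x. cmod (a x - b x) \<le> r"
  shows "energy a \<le> energy b + 2 * C * r"
proof -
  have "energy a \<le> (\<integral>x. (cmod (b x))\<^sup>2 + 2 * C * r \<partial>\<mu>)"
    unfolding energy_def
    by (intro integral_mono energy_integrable Bochner_Integration.integrable_add integrable_const c norm_square_diff_le assms)
  also have "\<dots> = energy b + 2 * C * r"
    using energy_integrable[OF c(2)] prob_space by (simp add: energy_def)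
  finally show ?thesis .
qed

lemma energy_parallelogram:
  assumes c: "continuous_on UNIV a" "continuous_on UNIV b"
  shows "energy (\<lambda>x. a x - b x) = 2 * energy a + 2 * energy b - 4 * energy (\<lambda>x. (a x + b x) / 2)"
proof -
  have "(cmod (a x - b x))\<^sup>2 = 2 * (cmod (a x))\<^sup>2 + 2 * (cmod (b x))\<^sup>2 - 4 * (cmod ((a x + b x) / 2))\<^sup>2" for x
    unfolding cmod_power2 by (simp add: field_simps power2_eq_square)
  then have "energy (\<lambda>x. a x - b x) =
      (\<integral>x. 2 * (cmod (a x))\<^sup>2 + 2 * (cmod (b x))\<^sup>2 - 4 * (cmod ((a x + b x) / 2))\<^sup>2 \<partial>\<mu>)"
    by (simp add: energy_def)
  moreover have "integrable \<mu> (\<lambda>x. (cmod ((a x + b x) / 2))\<^sup>2)"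
    by (intro energy_integrable continuous_intros c) simp
  ultimately show ?thesis
    using energy_integrable[OF c(1)] energy_integrable[OF c(2)] by (simp add: energy_def del: norm_divide)
qed

text \<open>\<open>A K F\<close> is uniformly close to \<open>A K (A M F)\<close>, and
  \<open>A K\<close> is an \<open>L^2\<close> contraction. The error is \<open>2 * C\<close> times
  the uniform distance \<open>2 * C * M / K\<close>.\<close>

lemma energy_A_asymptotically_minimal:
  assumes c: "continuous_on UNIV F" and C: "\<And>x. cmod (F x) \<le> C" and M: "0 < M" and K: "0 < K"
  shows "energy (A K F) \<le> energy (A M F) + 4 * C\<^sup>2 * M / K"
proof -
  have "energy (A K F) \<le> energy (A K (A M F)) + 2 * C * (M * (2 * C / K))"
    using norm_A_A_diff[where F = F, OF C M, where N = K]
    by (intro energy_perturb continuous_A c norm_A_le C) (simp add: norm_minus_commute)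
  also have "\<dots> \<le> energy (A M F) + 2 * C * (M * (2 * C / K))"
    by (intro add_right_mono energy_A_le continuous_A c K)
  finally show ?thesis by (simp add: power2_eq_square algebra_simps)
qed

text \<open>The infimum runs over the averages alone, not over the convex hull of the orbit;
  \<open>min_energy_le_midpoint\<close> supplies the convexity that the parallelogram argument
  needs.\<close>

definition min_energy :: "('a \<Rightarrow> complex) \<Rightarrow> real" where
  "min_energy F = (INF N\<in>{0<..}. energy (A N F))"

lemma min_energy_le: "0 < N \<Longrightarrow> min_energy F \<le> energy (A N F)"
  unfolding min_energy_def by (intro cINF_lower bdd_belowI2[of _ 0] energy_nonneg) auto

lemma energy_A_tendsto:
  assumes c: "continuous_on UNIV F"
  shows "(\<lambda>N. energy (A N F)) \<longlonglongrightarrow> min_energy F"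
proof (rule LIMSEQ_I)
  fix e :: real assume e: "0 < e"
  obtain C where C: "\<And>x. cmod (F x) \<le> C" using bounded_continuous[OF c] by blast
  have "min_energy F < min_energy F + e / 2" using e by simp
  then obtain M where M: "0 < M" "energy (A M F) < min_energy F + e / 2"
    unfolding min_energy_def
    by (subst (asm) cINF_less_iff) (auto intro!: bdd_belowI2[of _ 0] energy_nonneg)
  have "(\<lambda>K. 4 * C\<^sup>2 * M / real K) \<longlonglongrightarrow> 0" by (rule lim_const_over_n)
  from LIMSEQ_D[OF this, of "e/2"] e obtain n where n: "\<And>K. n \<le> K \<Longrightarrow> \<bar>4 * C\<^sup>2 * M / real K\<bar> < e / 2"
    by auto
  have "norm (energy (A K F) - min_energy F) < e" if "Suc n \<le> K" for K
    using energy_A_asymptotically_minimal[OF c C M(1), of K] M(2) n[of K] that min_energy_le[of K F] by simp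
  then show "\<exists>n. \<forall>K\<ge>n. norm (energy (A K F) - min_energy F) < e" by blast
qed

text \<open>The midpoint \<open>?h\<close> need not be an average of \<open>F\<close>, so it does
  not compete in the infimum. But \<open>A K ?h\<close> approaches \<open>A K F\<close> uniformly as
  \<open>K\<close> grows, and applying \<open>A K\<close> does not increase the energy of
  \<open>?h\<close>.\<close>

lemma min_energy_le_midpoint:
  assumes c: "continuous_on UNIV F" and N: "0 < N" and M: "0 < M"
  shows "min_energy F \<le> energy (\<lambda>x. (A N F x + A M F x) / 2)"
proof -
  obtain C where C: "\<And>x. cmod (F x) \<le> C" using bounded_continuous[OF c] by blast
  let ?h = "\<lambda>x. (A N F x + A M F x) / 2"
  have ch: "continuous_on UNIV ?h" by (intro continuous_intros c) simp
  have hC: "cmod (?h x) \<le> C" for x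
    using norm_triangle_ineq[of "A N F x" "A M F x"] norm_A_le[where F = F, OF C, where N = N and x = x] norm_A_le[where F = F, OF C, where N = M and x = x]
    by (simp add: norm_divide)
  have "min_energy F \<le> energy ?h + 2 * C * ((N + M) * C) / K" if K: "0 < K" for K :: nat
  proof -
    have d: "cmod (A K F x - A K ?h x) \<le> (N + M) * C / K" for x
    proof -
      have "A K F x - A K ?h x = - ((A K (A N F) x - A K F x) + (A K (A M F) x - A K F x)) / 2"
        by (simp add: A_half_add field_simps)
      then have "cmod (A K F x - A K ?h x) = cmod ((A K (A N F) x - A K F x) + (A K (A M F) x - A K F x)) / 2"
        by (simp only: norm_divide norm_minus_cancel) simp
      also have "\<dots> \<le> (N * (2 * C / K) + M * (2 * C / K)) / 2"
        by (intro divide_right_mono norm_triangle_mono norm_A_A_diff C N M) auto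
      also have "\<dots> = (N + M) * C / K" by (simp add: algebra_simps add_divide_distrib)
      finally show ?thesis .
    qed
    have "min_energy F \<le> energy (A K F)" by (rule min_energy_le[OF K])
    also have "\<dots> \<le> energy (A K ?h) + 2 * C * ((N + M) * C / K)"
      by (intro energy_perturb continuous_A c ch norm_A_le C hC d)
    also have "energy (A K ?h) \<le> energy ?h" by (rule energy_A_le[OF ch K])
    finally show ?thesis by simp
  qed
  then have "\<forall>\<^sub>F K in sequentially. min_energy F \<le> energy ?h + 2 * C * ((N + M) * C) / real K"
    by (intro eventually_sequentiallyI[of 1]) auto
  moreover have "(\<lambda>K. energy ?h + 2 * C * ((N + M) * C) / real K) \<longlonglongrightarrow> energy ?h + 0"
    by (intro tendsto_intros lim_const_over_n)
  ultimately show ?thesis using tendsto_lowerbound by force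
qed

lemma energy_A_diff_le:
  assumes c: "continuous_on UNIV F" and N: "0 < N" and M: "0 < M"
  shows "energy (\<lambda>x. A N F x - A M F x) \<le> 2 * (energy (A N F) - min_energy F) + 2 * (energy (A M F) - min_energy F)"
  using energy_parallelogram[of "A N F" "A M F"] min_energy_le_midpoint[OF assms] continuous_A[OF c] by simp

lemma integral_norm_le_energy:
  assumes "continuous_on UNIV h" "energy h \<le> r\<^sup>2" "0 \<le> r"
  shows "(\<integral>x. cmod (h x) \<partial>\<mu>) \<le> r"
proof -
  have "(\<integral>x. cmod (h x) \<partial>\<mu>)\<^sup>2 \<le> energy h"
    unfolding energy_def
    by (intro integral_square_le energy_integrable assms integrable_continuous continuous_intros)
  also note assms(2)
  finally show ?thesis by (rule power2_le_imp_le) (rule assms)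
qed

lemma AE_summable:
  fixes d :: "nat \<Rightarrow> 'a \<Rightarrow> complex"
  assumes d: "\<And>j. integrable \<mu> (d j)" and le: "\<And>j. (\<integral>x. cmod (d j x) \<partial>\<mu>) \<le> (1/2) ^ j"
  shows "AE x in \<mu>. summable (\<lambda>j. d j x)"
proof -
  note [measurable] = borel_measurable_integrable[OF d]
  have "(\<integral>\<^sup>+x. (\<Sum>j. ennreal (cmod (d j x))) \<partial>\<mu>) = (\<Sum>j. \<integral>\<^sup>+x. ennreal (cmod (d j x)) \<partial>\<mu>)"
    by (rule nn_integral_suminf) measurable
  also have "\<dots> = (\<Sum>j. ennreal (\<integral>x. cmod (d j x) \<partial>\<mu>))"
    using d by (intro suminf_cong nn_integral_eq_integral) auto
  also have "\<dots> \<le> (\<Sum>j. ennreal ((1/2) ^ j))" by (intro suminf_le ennreal_leI le) auto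
  also have "\<dots> = ennreal (1 / (1 - 1/2))"
    by (rule suminf_ennreal_eq[OF _ geometric_sums]) auto
  also have "\<dots> < \<top>" by simp
  finally have "(\<integral>\<^sup>+x. (\<Sum>j. ennreal (cmod (d j x))) \<partial>\<mu>) \<noteq> \<infinity>" by (simp add: less_top)
  then have "AE x in \<mu>. (\<Sum>j. ennreal (cmod (d j x))) \<noteq> \<infinity>"
    by (intro nn_integral_PInf_AE) measurable
  then show ?thesis
    by eventually_elim (rule summable_norm_cancel, rule summable_suminf_not_top, auto)
qed

text \<open>A minimising subsequence is Cauchy in \<open>L\<^sup>2\<close> by the parallelogram law; its almost everywhere
  limit is the projection of \<open>F\<close> onto the fixed space.\<close>
lemma AE_limit_fixed:
  assumes c: "continuous_on UNIV F" and C: "\<And>x. cmod (F x) \<le> C"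
  obtains N :: "nat \<Rightarrow> nat" and g where "\<And>j. 0 < N j" "g \<in> borel_measurable \<mu>" "AE x in \<mu>. cmod (g x) \<le> C"
    "AE x in \<mu>. g (\<theta> x) * u x = g x" "AE x in \<mu>. (\<lambda>j. A (N j) F x) \<longlonglongrightarrow> g x"
proof -
  \<comment> \<open>The rate \<open>(1/4)^j / 4\<close> makes the increments have \<open>L^2\<close>
    norm at most \<open>(1/2)^j\<close>, hence summable \<open>L^1\<close> norms. The condition
    \<open>Suc j \<le> N\<close> makes the equivariance defect \<open>2 * C / N\<close> vanish in
    the limit.\<close>
  have "\<exists>N\<ge>Suc j. energy (A N F) - min_energy F \<le> (1/4)^j / 4" for j
  proof -
    have "0 < (1/4::real)^j / 4" by simp
    from LIMSEQ_D[OF energy_A_tendsto[OF c] this] obtain n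
      where "\<And>N. n \<le> N \<Longrightarrow> norm (energy (A N F) - min_energy F) < (1/4)^j / 4" by blast
    from this[of "max n (Suc j)"] have "energy (A (max n (Suc j)) F) - min_energy F \<le> (1/4)^j / 4"
      by (metis real_norm_def abs_le_D1 less_imp_le max.cobounded1)
    then show ?thesis by (intro exI[of _ "max n (Suc j)"]) simp
  qed
  then obtain N where N: "\<And>j. Suc j \<le> N j" and en: "\<And>j. energy (A (N j) F) - min_energy F \<le> (1/4)^j / 4"
    by metis
  have pos: "0 < N j" for j using N[of j] by linarith
  define d where "d j x = A (N (Suc j)) F x - A (N j) F x" for j x
  have cd: "continuous_on UNIV (d j)" for j unfolding d_def by (intro continuous_intros c)
  have "energy (d j) \<le> ((1/2)^j)\<^sup>2" for j
  proof -
    have "energy (d j) \<le> 2 * ((1/4)^Suc j / 4) + 2 * ((1/4)^j / 4)"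
      using energy_A_diff_le[OF c pos pos, of "Suc j" j] en[of j] en[of "Suc j"] by (simp add: d_def[abs_def])
    also have "\<dots> \<le> (1/4)^j" by simp
    also have "\<dots> = ((1/2)^j)\<^sup>2" by (simp add: power2_eq_square flip: power_mult_distrib)
    finally show ?thesis .
  qed
  then have "(\<integral>x. cmod (d j x) \<partial>\<mu>) \<le> (1/2)^j" for j by (intro integral_norm_le_energy cd) auto
  then have "AE x in \<mu>. summable (\<lambda>j. d j x)" by (intro AE_summable integrable_continuous cd)
  then have conv: "AE x in \<mu>. (\<lambda>j. A (N j) F x) \<longlonglongrightarrow> lim (\<lambda>j. A (N j) F x)"
  proof eventually_elim
    case (elim x)
    have "(\<lambda>n. \<Sum>j<n. d j x) = (\<lambda>n. A (N n) F x - A (N 0) F x)"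
      unfolding d_def by (rule ext) (rule sum_lessThan_telescope)
    then have "convergent (\<lambda>n. A (N n) F x - A (N 0) F x)" using elim by (simp add: summable_iff_convergent)
    then have "convergent (\<lambda>n. A (N n) F x)"
      using convergent_add[OF _ convergent_const[of "A (N 0) F x"]] by fastforce
    then show ?case by (simp add: convergent_LIMSEQ_iff)
  qed
  show ?thesis
  proof (rule that[OF pos _ _ _ conv])
    show "(\<lambda>x. lim (\<lambda>j. A (N j) F x)) \<in> borel_measurable \<mu>"
      by (intro borel_measurable_lim_metric continuous_measurable continuous_A c)
    show "AE x in \<mu>. cmod (lim (\<lambda>j. A (N j) F x)) \<le> C"
      using conv
    proof eventually_elim
      case (elim x)
      from tendsto_norm[OF elim] show ?case
        by (rule tendsto_upperbound) (auto intro!: always_eventually norm_A_le[where F = F] C)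
    qed
    show "AE x in \<mu>. lim (\<lambda>j. A (N j) F (\<theta> x)) * u x = lim (\<lambda>j. A (N j) F x)"
      using conv AE_theta[OF conv]
    proof eventually_elim
      case (elim x)
      have C0: "0 \<le> C" using C norm_ge_zero order_trans by blast
      have "(\<lambda>j. u x * A (N j) F (\<theta> x) - A (N j) F x) \<longlonglongrightarrow> 0"
      proof (rule Lim_null_comparison)
        have "norm (u x * A (N j) F (\<theta> x) - A (N j) F x) \<le> 2 * C / Suc j" for j
        proof -
          have "norm (u x * A (N j) F (\<theta> x) - A (N j) F x) \<le> 2 * C / N j"
            unfolding A_equivariant by (rule norm_A_W1_diff[where F = F, OF C])
          also have "\<dots> \<le> 2 * C / Suc j" using N[of j] C0 by (intro divide_left_mono) auto
          finally show ?thesis .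
        qed
        then show "\<forall>\<^sub>F j in sequentially. norm (u x * A (N j) F (\<theta> x) - A (N j) F x) \<le> 2 * C / Suc j" by simp
        show "(\<lambda>j. 2 * C / Suc j) \<longlonglongrightarrow> 0" by (rule LIMSEQ_Suc) (rule lim_const_over_n)
      qed
      moreover have "(\<lambda>j. u x * A (N j) F (\<theta> x) - A (N j) F x) \<longlonglongrightarrow>
          u x * lim (\<lambda>j. A (N j) F (\<theta> x)) - lim (\<lambda>j. A (N j) F x)"
        by (intro tendsto_intros elim)
      ultimately have "u x * lim (\<lambda>j. A (N j) F (\<theta> x)) - lim (\<lambda>j. A (N j) F x) = 0"
        using LIMSEQ_unique by blast
      then show ?case by (simp add: mult.commute)
    qed
  qed
qed

lemma uniform_limit_of_L1_limit:
  assumes c: "continuous_on UNIV F"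
    and small: "\<And>e. 0 < e \<Longrightarrow> \<exists>M>0. (\<integral>x. cmod (A M F x) \<partial>\<mu>) < e"
  shows "uniform_limit UNIV (\<lambda>N. A N F) (\<lambda>_. 0) sequentially"
proof (rule uniform_limitI)
  fix e :: real assume e: "0 < e"
  obtain C where C: "\<And>x. cmod (F x) \<le> C" using bounded_continuous[OF c] by blast
  \<comment> \<open>A single \<open>M\<close> is enough: \<open>e/3\<close> bounds the mean of
    \<open>\<bar>A M F\<bar>\<close>, another \<open>e/3\<close> the distance of its unweighted
    averages from that mean, and the last one the replacement of \<open>A N F\<close> by
    \<open>A N (A M F)\<close>.\<close>
  from small[of "e/3"] e obtain M where M: "0 < M" "(\<integral>x. cmod (A M F x) \<partial>\<mu>) < e/3" by auto
  have "continuous_on UNIV (\<lambda>x. cmod (A M F x))" by (intro continuous_intros c)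
  from uniform_limitD[OF birkhoff_uniform_limit[OF this], of "e/3"] e
  have "\<forall>\<^sub>F N in sequentially. \<forall>x\<in>UNIV.
      dist (birkhoff \<theta> N (\<lambda>x. cmod (A M F x)) x) (\<integral>x. cmod (A M F x) \<partial>\<mu>) < e/3" by simp
  then have "\<forall>\<^sub>F N in sequentially. \<forall>x. birkhoff \<theta> N (\<lambda>x. cmod (A M F x)) x < 2 * e / 3"
  proof eventually_elim
    case (elim N)
    show ?case
    proof
      fix x
      show "birkhoff \<theta> N (\<lambda>x. cmod (A M F x)) x < 2 * e / 3"
        using bspec[OF elim UNIV_I, of x] M(2) unfolding dist_real_def by linarith
    qed
  qed
  moreover have "\<forall>\<^sub>F N in sequentially. 2 * C * M / real N < e / 3"
    using order_tendstoD(2)[OF lim_const_over_n[of "2 * C * M"], of "e/3"] e by simp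
  ultimately show "\<forall>\<^sub>F N in sequentially. \<forall>x\<in>UNIV. dist (A N F x) 0 < e"
  proof eventually_elim
    case (elim N)
    show ?case
    proof
      fix x
      have "cmod (A N F x) \<le> cmod (A N (A M F) x) + cmod (A N (A M F) x - A N F x)"
        using norm_triangle_sub[of "A N F x" "A N (A M F) x"] by (simp add: norm_minus_commute)
      also have "\<dots> \<le> birkhoff \<theta> N (\<lambda>x. cmod (A M F x)) x + M * (2 * C / N)"
        by (intro add_mono norm_A_le_birkhoff norm_A_A_diff C M)
      also have "M * (2 * C / N) = 2 * C * M / N" by simp
      also have "birkhoff \<theta> N (\<lambda>x. cmod (A M F x)) x + \<dots> < e"
        using elim(2) spec[OF elim(1), of x] by linarith
      finally show "dist (A N F x) 0 < e" by simp
    qed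
  qed
qed

theorem uniform_limit_if_fixed_continuous:
  assumes fixed: "\<And>g. g \<in> borel_measurable \<mu> \<Longrightarrow> \<exists>C. AE x in \<mu>. cmod (g x) \<le> C \<Longrightarrow>
      AE x in \<mu>. g (\<theta> x) * u x = g x \<Longrightarrow>
      \<exists>G. continuous_on UNIV G \<and> (\<forall>x. G (\<theta> x) * u x = G x) \<and> (AE x in \<mu>. g x = G x)"
    and c: "continuous_on UNIV F"
  obtains G where "continuous_on UNIV G" "uniform_limit UNIV (\<lambda>N. A N F) G sequentially"
proof -
  obtain C where C: "\<And>x. cmod (F x) \<le> C" using bounded_continuous[OF c] by blast
  obtain N :: "nat \<Rightarrow> nat" and g where N: "\<And>j. 0 < N j" and g: "g \<in> borel_measurable \<mu>" "AE x in \<mu>. cmod (g x) \<le> C"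
    "AE x in \<mu>. g (\<theta> x) * u x = g x" and conv: "AE x in \<mu>. (\<lambda>j. A (N j) F x) \<longlonglongrightarrow> g x"
    by (rule AE_limit_fixed[where F = F, OF c C]) (rule that)
  from fixed[OF g(1) _ g(3)] g(2) obtain G where cG: "continuous_on UNIV G"
    and G: "\<And>x. G (\<theta> x) * u x = G x" and gG: "AE x in \<mu>. g x = G x" by auto
  \<comment> \<open>Since averages of positive length fix \<open>G\<close>, subtracting it turns
    convergence to \<open>G\<close> into convergence to 0, the form in which smallness in mean
    becomes uniform smallness.\<close>
  let ?F = "\<lambda>x. F x - G x"
  have cF: "continuous_on UNIV ?F" by (intro continuous_intros c cG)
  obtain D where D: "\<And>x. cmod (?F x) \<le> D" using bounded_continuous[OF cF] by blast
  have A: "A n ?F x = A n F x - G x" if "0 < n" for n x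
    using A_fixed[where G = G, OF G that] by (simp add: A_diff)
  have "(\<lambda>j. \<integral>x. cmod (A (N j) ?F x) \<partial>\<mu>) \<longlonglongrightarrow> (\<integral>x. 0 \<partial>\<mu>)"
  proof (rule integral_dominated_convergence[where w = "\<lambda>_. D"])
    show "AE x in \<mu>. (\<lambda>j. cmod (A (N j) ?F x)) \<longlonglongrightarrow> 0"
      using conv gG
    proof eventually_elim
      case (elim x)
      have "(\<lambda>j. cmod (A (N j) F x - G x)) \<longlonglongrightarrow> cmod (g x - G x)" by (intro tendsto_intros elim)
      then show ?case using elim(2) by (simp add: A[OF N])
    qed
    show "\<And>j. (\<lambda>x. cmod (A (N j) ?F x)) \<in> borel_measurable \<mu>"
      by (intro continuous_measurable continuous_intros cF)
    show "\<And>j. AE x in \<mu>. norm (cmod (A (N j) ?F x)) \<le> D" using norm_A_le[where F = ?F, OF D] by simp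
  qed auto
  then have lim0: "(\<lambda>j. \<integral>x. cmod (A (N j) ?F x) \<partial>\<mu>) \<longlonglongrightarrow> 0" by simp
  have "uniform_limit UNIV (\<lambda>n. A n ?F) (\<lambda>_. 0) sequentially"
  proof (rule uniform_limit_of_L1_limit[OF cF])
    fix e :: real assume "0 < e"
    from order_tendstoD(2)[OF lim0 this] obtain j where "(\<integral>x. cmod (A (N j) ?F x) \<partial>\<mu>) < e"
      by (auto simp: eventually_sequentially)
    then show "\<exists>M>0. (\<integral>x. cmod (A M ?F x) \<partial>\<mu>) < e" using N by blast
  qed
  \<comment> \<open>The two families agree only for \<open>n > 0\<close>: the average of length 0 is
    0 by the division convention and does not fix \<open>G\<close>.\<close>
  then have "uniform_limit UNIV (\<lambda>n x. A n F x - G x) (\<lambda>_. 0) sequentially"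
    by (rule uniform_limit_cong[THEN iffD1, rotated 2])
       (auto simp: A eventually_sequentially intro!: exI[of _ 1])
  from uniform_limit_add[OF this uniform_limit_const[where c = G]]
  have "uniform_limit UNIV (\<lambda>n. A n F) G sequentially" by simp
  with cG show ?thesis by (rule that)
qed

section \<open>Density of the continuous functions in \<open>L^1\<close>\<close>

lemma integrable_indicator_approx:
  fixes c :: complex
  assumes B: "B \<in> sets borel" and e: "0 < e"
  shows "\<exists>F. continuous_on UNIV F \<and> (\<integral>x. cmod (indicator B x *\<^sub>R c - F x) \<partial>\<mu>) < e"
proof -
  \<comment> \<open>Adding 1 keeps the divisor \<open>2 * a\<close> positive and the final
    inequality strict even when \<open>c = 0\<close>.\<close>
  define a where "a = cmod c + 1"
  have a: "0 < a" "cmod c < a" using norm_ge_zero[of c] unfolding a_def by linarith+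
  define r where "r = e / (2 * a)"
  have r: "0 < r" using e a by (simp add: r_def)
  from regular_outer[OF regular B r] obtain U where U: "open U" "B \<subseteq> U" "prob (U - B) < r" .
  have "- B \<in> sets borel" using B by auto
  from regular_outer[OF regular this r] obtain V where V: "open V" "- B \<subseteq> V" "prob (V - - B) < r" .
  \<comment> \<open>\<open>- V\<close> lies inside \<open>B\<close> and \<open>B\<close> inside
    \<open>U\<close>, so \<open>- U\<close> and \<open>- V\<close> are disjoint closed sets;
    \<open>\<psi>\<close> can differ from the indicator of \<open>B\<close> only on the small sets
    \<open>U - B\<close> and \<open>V - - B\<close>.\<close>
  obtain \<psi> :: "'a \<Rightarrow> real" where \<psi>: "continuous_on UNIV \<psi>" "\<And>x. 0 \<le> \<psi> x" "\<And>x. \<psi> x \<le> 1"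
    "\<And>x. x \<in> - U \<Longrightarrow> \<psi> x = 0" "\<And>x. x \<in> - V \<Longrightarrow> \<psi> x = 1"
    by (rule compact_t2_Urysohn[OF compact_UNIV, of "- U" "- V"]) (use U V in auto)
  have cF: "continuous_on UNIV (\<lambda>x. \<psi> x *\<^sub>R c)" by (intro continuous_intros \<psi>(1))
  have UB: "U - B \<in> sets borel" "V - - B \<in> sets borel" using U V B by auto
  have pw: "cmod (indicator B x *\<^sub>R c - \<psi> x *\<^sub>R c) \<le> cmod c * (indicator (U - B) x + indicator (V - - B) x)" for x
  proof -
    have "\<bar>indicator B x - \<psi> x\<bar> \<le> indicator (U - B) x + indicator (V - - B) x"
      using \<psi>(2,3)[of x] \<psi>(4,5)[of x] U(2) by (auto simp: indicator_def)
    from mult_left_mono[OF this norm_ge_zero[of c]] show ?thesis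
      by (simp add: mult.commute flip: scaleR_left_diff_distrib)
  qed
  have int: "integrable \<mu> (indicator (U - B) :: 'a \<Rightarrow> real)" "integrable \<mu> (indicator (V - - B) :: 'a \<Rightarrow> real)"
    using UB by (auto simp: emeasure_eq_measure)
  have "integrable \<mu> (\<lambda>x. indicator B x *\<^sub>R c)" using B by (auto simp: emeasure_eq_measure)
  then have "integrable \<mu> (\<lambda>x. cmod (indicator B x *\<^sub>R c - \<psi> x *\<^sub>R c))"
    by (intro integrable_norm Bochner_Integration.integrable_diff integrable_continuous[OF cF])
  then have "(\<integral>x. cmod (indicator B x *\<^sub>R c - \<psi> x *\<^sub>R c) \<partial>\<mu>) \<le>
      (\<integral>x. cmod c * (indicator (U - B) x + indicator (V - - B) x) \<partial>\<mu>)"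
    by (intro integral_mono pw integrable_mult_right Bochner_Integration.integrable_add int)
  also have "\<dots> = cmod c * (prob (U - B) + prob (V - - B))"
    using int by simp
  also have "\<dots> \<le> cmod c * (2 * r)" using U(3) V(3) by (intro mult_left_mono) auto
  also have "\<dots> < a * (2 * r)" using r a by simp
  also have "\<dots> = e" using a by (simp add: r_def)
  finally show ?thesis using cF by blast
qed

lemma continuous_dense_L1:
  fixes g :: "'a \<Rightarrow> complex"
  assumes "integrable \<mu> g" "0 < e"
  shows "\<exists>F. continuous_on UNIV F \<and> (\<integral>x. cmod (g x - F x) \<partial>\<mu>) < e"
  using assms
proof (induction g arbitrary: e rule: integrable_induct)
  case (base B c)
  then show ?case using integrable_indicator_approx[of B e c] by simp
next
  case (add f g)
  obtain F G where FG: "continuous_on UNIV F" "(\<integral>x. cmod (f x - F x) \<partial>\<mu>) < e/2"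
    "continuous_on UNIV G" "(\<integral>x. cmod (g x - G x) \<partial>\<mu>) < e/2"
    using add.IH[of "e/2"] add.prems by auto
  note int = Bochner_Integration.integrable_diff[OF add.hyps(1) integrable_continuous[OF FG(1)]]
    Bochner_Integration.integrable_diff[OF add.hyps(2) integrable_continuous[OF FG(3)]]
  have "(\<integral>x. cmod (f x + g x - (F x + G x)) \<partial>\<mu>) \<le> (\<integral>x. cmod (f x - F x) + cmod (g x - G x) \<partial>\<mu>)"
  proof (rule integral_mono)
    show "integrable \<mu> (\<lambda>x. cmod (f x + g x - (F x + G x)))"
      by (intro integrable_norm Bochner_Integration.integrable_diff[OF Bochner_Integration.integrable_add[OF add.hyps(1,2)]
          integrable_continuous] continuous_on_add FG)
    show "cmod (f x + g x - (F x + G x)) \<le> cmod (f x - F x) + cmod (g x - G x)" for x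
      using norm_triangle_ineq[of "f x - F x" "g x - G x"] by (simp add: algebra_simps)
  qed (use int in \<open>simp add: integrable_norm\<close>)
  also have "\<dots> = (\<integral>x. cmod (f x - F x) \<partial>\<mu>) + (\<integral>x. cmod (g x - G x) \<partial>\<mu>)"
    using int by (simp add: integrable_norm)
  also have "\<dots> < e" using FG by linarith
  finally show ?case using FG continuous_on_add by blast
next
  case (lim f s)
  have "(\<lambda>i. \<integral>x. cmod (f x - s i x) \<partial>\<mu>) \<longlonglongrightarrow> (\<integral>x. 0 \<partial>\<mu>)"
  \<comment> \<open>The approximants provided by \<open>integrable_induct\<close> satisfy
    \<open>cmod (s i x) \<le> 2 * cmod (f x)\<close>; together with \<open>f\<close> itself this
    gives the factor 3.\<close>
  proof (rule integral_dominated_convergence[where w = "\<lambda>x. 3 * cmod (f x)"])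
    show "AE x in \<mu>. (\<lambda>i. cmod (f x - s i x)) \<longlonglongrightarrow> 0"
    proof (rule AE_I2)
      fix x assume "x \<in> space \<mu>"
      from tendsto_norm[OF tendsto_diff[OF tendsto_const lim.hyps(2)[OF this]], of "f x"]
      show "(\<lambda>i. cmod (f x - s i x)) \<longlonglongrightarrow> 0" by simp
    qed
    show "AE x in \<mu>. norm (cmod (f x - s i x)) \<le> 3 * cmod (f x)" for i
    proof (rule AE_I2)
      fix x assume "x \<in> space \<mu>"
      from lim.hyps(3)[OF this, of i] norm_triangle_ineq4[of "f x" "s i x"]
      show "norm (cmod (f x - s i x)) \<le> 3 * cmod (f x)" by simp
    qed
    show "integrable \<mu> (\<lambda>x. 3 * cmod (f x))" using lim.hyps(4) by (simp add: integrable_norm)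
    show "(\<lambda>x. cmod (f x - s i x)) \<in> borel_measurable \<mu>" for i
      using borel_measurable_integrable[OF lim.hyps(1)] borel_measurable_integrable[OF lim.hyps(4)] by measurable
  qed simp
  then have "(\<lambda>i. \<integral>x. cmod (f x - s i x) \<partial>\<mu>) \<longlonglongrightarrow> 0" by simp
  from order_tendstoD(2)[OF this, of "e/2"] lim.prems
  obtain i where i: "(\<integral>x. cmod (f x - s i x) \<partial>\<mu>) < e/2" by (auto simp: eventually_sequentially)
  obtain F where F: "continuous_on UNIV F" "(\<integral>x. cmod (s i x - F x) \<partial>\<mu>) < e/2"
    using lim.IH[of "e/2" i] lim.prems by auto
  have int: "integrable \<mu> (\<lambda>x. cmod (f x - s i x))" "integrable \<mu> (\<lambda>x. cmod (s i x - F x))" "integrable \<mu> (\<lambda>x. cmod (f x - F x))"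
    using lim.hyps(1,4) integrable_continuous[OF F(1)]
    by (intro integrable_norm Bochner_Integration.integrable_diff; simp)+
  have "(\<integral>x. cmod (f x - F x) \<partial>\<mu>) \<le> (\<integral>x. cmod (f x - s i x) + cmod (s i x - F x) \<partial>\<mu>)"
    using norm_triangle_ineq[of "f x - s i x" "s i x - F x" for x]
    by (intro integral_mono int Bochner_Integration.integrable_add) simp
  also have "\<dots> < e" using int i F by simp
  finally show ?case using F by blast
qed

section \<open>From uniform convergence to continuity of fixed functions\<close>

lemma uniform_limit_fixed:
  assumes c: "continuous_on UNIV F" and G: "uniform_limit UNIV (\<lambda>N. A N F) G sequentially"
  shows "G (\<theta> x) * u x = G x"
proof -
  obtain C where C: "\<And>x. cmod (F x) \<le> C" using bounded_continuous[OF c] by blast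
  have lim: "(\<lambda>N. A N F y) \<longlonglongrightarrow> G y" for y using tendsto_uniform_limitI[OF G] by simp
  have "(\<lambda>N. u x * A N F (\<theta> x) - A N F x) \<longlonglongrightarrow> u x * G (\<theta> x) - G x" by (intro tendsto_intros lim)
  moreover have "(\<lambda>N. u x * A N F (\<theta> x) - A N F x) \<longlonglongrightarrow> 0"
  proof (rule Lim_null_comparison)
    show "\<forall>\<^sub>F N in sequentially. norm (u x * A N F (\<theta> x) - A N F x) \<le> 2 * C / N"
      unfolding A_equivariant by (intro always_eventually allI norm_A_W1_diff[where F = F] C)
  qed (rule lim_const_over_n)
  ultimately have "u x * G (\<theta> x) - G x = 0" by (rule LIMSEQ_unique)
  then show ?thesis by (simp add: mult.commute)
qed

text \<open>For positive \<open>N\<close>, \<open>A N\<close> fixes \<open>g\<close> almost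
  everywhere and is an \<open>L^1\<close> contraction, so averaging \<open>F\<close> cannot move it
  away from \<open>g\<close> in mean. The uniform limit \<open>G\<close> inherits this.\<close>

lemma L1_dist_limit_le:
  assumes cF: "continuous_on UNIV F" and G: "uniform_limit UNIV (\<lambda>N. A N F) G sequentially"
    and cG: "continuous_on UNIV G"
    and g: "integrable \<mu> g" and inv: "AE x in \<mu>. g (\<theta> x) * u x = g x"
  shows "(\<integral>x. cmod (g x - G x) \<partial>\<mu>) \<le> (\<integral>x. cmod (g x - F x) \<partial>\<mu>)"
proof (rule field_le_epsilon)
  fix e :: real assume e: "0 < e"
  from uniform_limitD[OF G e] obtain n where n: "\<And>N x. n \<le> N \<Longrightarrow> dist (A N F x) (G x) < e"
    by (auto simp: eventually_sequentially)
  define N where "N = Suc n"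
  let ?h = "\<lambda>x. cmod (g x - F x)"
  have ih: "integrable \<mu> ?h" by (intro integrable_norm Bochner_Integration.integrable_diff g integrable_continuous cF)
  have "AE x in \<mu>. cmod (g x - G x) \<le> birkhoff \<theta> N ?h x + e"
    using AE_A_fixed[OF inv, of N, unfolded N_def, OF zero_less_Suc]
  proof eventually_elim
    case (elim x)
    have "g x - G x = A N (\<lambda>x. g x - F x) x + (A N F x - G x)"
      using elim by (simp add: A_diff N_def)
    then have "cmod (g x - G x) \<le> cmod (A N (\<lambda>x. g x - F x) x) + cmod (A N F x - G x)"
      by (metis norm_triangle_ineq)
    also have "\<dots> \<le> birkhoff \<theta> N ?h x + e"
      using n[of N x] by (intro add_mono norm_A_le_birkhoff) (simp add: N_def dist_norm)
    finally show ?case .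
  qed
  then have "(\<integral>x. cmod (g x - G x) \<partial>\<mu>) \<le> (\<integral>x. birkhoff \<theta> N ?h x + e \<partial>\<mu>)"
    using integral_birkhoff[OF ih, of N]
    by (intro integral_mono_AE integrable_norm Bochner_Integration.integrable_diff[OF g integrable_continuous[OF cG]]
        Bochner_Integration.integrable_add[OF _ integrable_const]) (auto simp: N_def)
  also have "\<dots> = (\<integral>x. ?h x \<partial>\<mu>) + e"
    using integral_birkhoff[OF ih, of N] prob_space by (simp add: N_def)
  finally show "(\<integral>x. cmod (g x - G x) \<partial>\<mu>) \<le> (\<integral>x. ?h x \<partial>\<mu>) + e" .
qed

text \<open>By ergodicity a nonzero fixed \<open>g\<close> has constant modulus and every other fixed function is a
  constant multiple of it; the limit \<open>G\<close> of averages of a continuous function close to \<open>g\<close> is a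
  nonzero such multiple.\<close>
theorem fixed_continuous_if_uniform_limit:
  assumes conv: "\<And>F. continuous_on UNIV F \<Longrightarrow>
      \<exists>G. continuous_on UNIV G \<and> uniform_limit UNIV (\<lambda>N. A N F) G sequentially"
    and g: "g \<in> borel_measurable \<mu>" and bd: "AE x in \<mu>. cmod (g x) \<le> C"
    and inv: "AE x in \<mu>. g (\<theta> x) * u x = g x"
  shows "\<exists>G. continuous_on UNIV G \<and> (\<forall>x. G (\<theta> x) * u x = G x) \<and> (AE x in \<mu>. g x = G x)"
proof -
  have g'[measurable]: "g \<in> borel_measurable borel" using g by simp
  have bd': "AE x in \<mu>. \<bar>cmod (g x)\<bar> \<le> C" using bd by simp
  have inv': "AE x in \<mu>. cmod (g (\<theta> x)) = cmod (g x)"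
    using inv
  proof eventually_elim
    case (elim x)
    from arg_cong[OF elim, of cmod] show ?case by (simp add: norm_mult norm_u)
  qed
  obtain c where c: "AE x in \<mu>. cmod (g x) = c"
    by (rule ergodic_real[OF _ inv' bd']) measurable
  show ?thesis
  proof (cases "c \<le> 0")
    case True
    from c have "AE x in \<mu>. g x = 0"
      by eventually_elim (use True in \<open>metis norm_le_zero_iff\<close>)
    then show ?thesis by (intro exI[of _ "\<lambda>_. 0"]) auto
  next
    case False
    then have c0: "0 < c" by simp
    have ig: "integrable \<mu> g" by (rule integrable_const_bound[OF bd g])
    \<comment> \<open>The threshold \<open>c\<close> is the \<open>L^1\<close> distance from
      \<open>g\<close> to 0. A limit \<open>G\<close> strictly closer than that cannot vanish almost
      everywhere, which later excludes \<open>d = 0\<close>.\<close>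
    from continuous_dense_L1[OF ig c0] obtain F where F: "continuous_on UNIV F" "(\<integral>x. cmod (g x - F x) \<partial>\<mu>) < c"
      by blast
    from conv[OF F(1)] obtain G where cG: "continuous_on UNIV G" and G: "uniform_limit UNIV (\<lambda>N. A N F) G sequentially"
      by blast
    have fixG: "G (\<theta> x) * u x = G x" for x by (rule uniform_limit_fixed[OF F(1) G])
    have less: "(\<integral>x. cmod (g x - G x) \<partial>\<mu>) < c" using L1_dist_limit_le[OF F(1) G cG ig inv] F(2) by linarith
    have mG[measurable]: "G \<in> borel_measurable borel" using continuous_measurable[OF cG] by simp
    obtain D where D: "\<And>x. cmod (G x) \<le> D" using bounded_continuous[OF cG] by blast
    have bdG: "AE x in \<mu>. cmod (G x * cnj (g x)) \<le> D * c"
      using c by eventually_elim (use D c0 in \<open>simp add: norm_mult mult_right_mono\<close>)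
    \<comment> \<open>Conjugating one factor makes the weight appear as
      \<open>u x * cnj (u x) = 1\<close>, so the product is invariant under \<open>\<theta>\<close>
      without any weight.\<close>
    have invG: "AE x in \<mu>. G (\<theta> x) * cnj (g (\<theta> x)) = G x * cnj (g x)"
      using inv
    proof eventually_elim
      case (elim x)
      have "G x * cnj (g x) = G (\<theta> x) * u x * cnj (g (\<theta> x) * u x)" using fixG[of x] elim by simp
      also have "\<dots> = G (\<theta> x) * cnj (g (\<theta> x)) * (u x * cnj (u x))" by simp
      also have "u x * cnj (u x) = 1" by (simp add: complex_norm_square[symmetric] norm_u)
      finally show ?case by simp
    qed
    have mGg: "(\<lambda>x. G x * cnj (g x)) \<in> borel_measurable borel"
      by (intro borel_measurable_times mG) (use g' borel_measurable_continuous_onI[OF continuous_on_cnj[OF continuous_on_id]] in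
          \<open>auto intro: measurable_compose[OF g']\<close>)
    obtain d where d: "AE x in \<mu>. G x * cnj (g x) = d"
      by (rule ergodic_complex[OF mGg invG bdG])
    \<comment> \<open>Multiplying \<open>G * cnj g = d\<close> by \<open>g\<close>, whose squared
      modulus is the square of \<open>c\<close>, solves for \<open>g\<close> as a multiple of
      \<open>G\<close>; the factor in the final witness is read off here.\<close>
    have dg: "AE x in \<mu>. G x * (complex_of_real c)\<^sup>2 = d * g x"
      using c d
    proof eventually_elim
      case (elim x)
      have "d * g x = G x * (g x * cnj (g x))" using elim by simp
      also have "g x * cnj (g x) = (complex_of_real c)\<^sup>2" using elim by (simp add: complex_norm_square[symmetric])
      finally show ?case by simp
    qed
    have "d \<noteq> 0"
    proof
      assume "d = 0"
      have "AE x in \<mu>. cmod (g x - G x) = c"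
        using dg c by eventually_elim (use c0 \<open>d = 0\<close> in auto)
      then have "(\<integral>x. cmod (g x - G x) \<partial>\<mu>) = (\<integral>x. c \<partial>\<mu>)"
        by (intro integral_cong_AE) auto
      then show False using less prob_space by simp
    qed
    show ?thesis
    proof (intro exI[of _ "\<lambda>x. (complex_of_real c)\<^sup>2 / d * G x"] conjI allI)
      show "continuous_on UNIV (\<lambda>x. (complex_of_real c)\<^sup>2 / d * G x)" by (intro continuous_intros cG)
      show "(complex_of_real c)\<^sup>2 / d * G (\<theta> x) * u x = (complex_of_real c)\<^sup>2 / d * G x" for x
        using fixG[of x] by (metis mult.assoc)
      show "AE x in \<mu>. g x = (complex_of_real c)\<^sup>2 / d * G x"
        using dg by eventually_elim (use \<open>d \<noteq> 0\<close> in \<open>simp add: field_simps\<close>)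
    qed
  qed
qed

end

section \<open>Skew products with the circle\<close>

definition orbit_average :: "('b \<Rightarrow> 'b) \<Rightarrow> nat \<Rightarrow> ('b \<Rightarrow> complex) \<Rightarrow> 'b \<Rightarrow> complex" where
  "orbit_average \<Phi> N h p = (\<Sum>k<N. h ((\<Phi> ^^ k) p)) / of_nat N"

lemma orbit_average_add:
  "orbit_average \<Phi> N (\<lambda>z. p z + q z) = (\<lambda>x. orbit_average \<Phi> N p x + orbit_average \<Phi> N q x)"
  by (rule ext) (simp add: orbit_average_def sum.distrib add_divide_distrib)

lemma norm_orbit_average_diff_le:
  assumes "\<And>z. z \<in> S \<Longrightarrow> cmod (h z - p z) \<le> e" "\<And>z. z \<in> S \<Longrightarrow> \<Phi> z \<in> S" "z \<in> S" "0 \<le> e"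
  shows "cmod (orbit_average \<Phi> N h z - orbit_average \<Phi> N p z) \<le> e"
proof (cases "N = 0")
  case False
  have inS: "(\<Phi> ^^ k) z \<in> S" for k by (induction k) (use assms in auto)
  have "cmod (\<Sum>k<N. h ((\<Phi> ^^ k) z) - p ((\<Phi> ^^ k) z)) \<le> (\<Sum>k<N. e)"
    by (rule order_trans[OF norm_sum sum_mono]) (intro assms inS)
  then show ?thesis using False
    by (simp add: orbit_average_def norm_divide sum_subtractf divide_le_eq mult.commute flip: diff_divide_distrib)
qed (use assms in \<open>simp add: orbit_average_def\<close>)

text \<open>Orbit averages are contractions for the sup norm on the invariant set \<open>S\<close>,
  so the uniform Cauchy property passes from \<open>p\<close> to \<open>h\<close> with budget
  \<open>e/4 + e/2 + e/4\<close>.\<close>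

lemma uniformly_convergent_orbit_average_approx:
  assumes inv: "\<And>z. z \<in> S \<Longrightarrow> \<Phi> z \<in> S"
    and approx: "\<And>e. 0 < e \<Longrightarrow> \<exists>p. (\<forall>z\<in>S. cmod (h z - p z) \<le> e) \<and>
      uniformly_convergent_on S (\<lambda>N. orbit_average \<Phi> N p)"
  shows "uniformly_convergent_on S (\<lambda>N. orbit_average \<Phi> N h)"
  unfolding uniformly_convergent_eq_Cauchy
proof (rule uniformly_Cauchy_onI)
  fix e :: real assume e: "0 < e"
  then obtain p where p: "\<And>z. z \<in> S \<Longrightarrow> cmod (h z - p z) \<le> e/4"
    and conv: "uniformly_convergent_on S (\<lambda>N. orbit_average \<Phi> N p)" using approx[of "e/4"] by auto
  from uniformly_convergent_Cauchy[OF conv] e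
  obtain M where M: "\<And>z m n. z \<in> S \<Longrightarrow> M \<le> m \<Longrightarrow> M \<le> n \<Longrightarrow>
      dist (orbit_average \<Phi> m p z) (orbit_average \<Phi> n p z) < e/2"
    unfolding uniformly_Cauchy_on_def by (meson half_gt_zero)
  have "dist (orbit_average \<Phi> m h z) (orbit_average \<Phi> n h z) < e" if "z \<in> S" "M \<le> m" "M \<le> n" for z m n
  proof -
    have "dist (orbit_average \<Phi> N h z) (orbit_average \<Phi> N p z) \<le> e/4" for N
      unfolding dist_norm using norm_orbit_average_diff_le[OF p inv that(1)] e by simp
    from this[of m] this[of n] M[OF that] show ?thesis
      using dist_triangle[of "orbit_average \<Phi> m h z" "orbit_average \<Phi> n h z" "orbit_average \<Phi> m p z"]
        dist_triangle[of "orbit_average \<Phi> m p z" "orbit_average \<Phi> n h z" "orbit_average \<Phi> n p z"]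
      by (simp add: dist_commute)
  qed
  then show "\<exists>M. \<forall>x\<in>S. \<forall>m\<ge>M. \<forall>n\<ge>M. dist (orbit_average \<Phi> m h x) (orbit_average \<Phi> n h x) < e" by blast
qed

section \<open>Trigonometric polynomials in the circle variable and their density\<close>

inductive_set trig :: "('a::t2_space \<times> complex \<Rightarrow> complex) set" where
  monomial: "continuous_on UNIV F \<Longrightarrow> (\<lambda>(x, w). F x * w powi n) \<in> trig"
| add: "p \<in> trig \<Longrightarrow> q \<in> trig \<Longrightarrow> (\<lambda>z. p z + q z) \<in> trig"

abbreviation (input) cylinder :: "('a \<times> complex) set" where
  "cylinder \<equiv> UNIV \<times> sphere 0 1"

lemma continuous_monomial:
  fixes F :: "'a::t2_space \<Rightarrow> complex"
  assumes "continuous_on UNIV F"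
  shows "continuous_on cylinder (\<lambda>(x, w). F x * w powi n)"
  unfolding case_prod_beta
  by (intro continuous_intros continuous_on_compose2[OF assms]) auto

lemma continuous_trig: "p \<in> trig \<Longrightarrow> continuous_on cylinder p"
  by (induction rule: trig.induct) (auto intro: continuous_monomial continuous_on_add)

text \<open>Equality is claimed on the cylinder only, since \<open>w powi (n + m)\<close> can fail
  to split at \<open>w = 0\<close>; on the circle exponents add.\<close>

lemma trig_mult_monomial:
  fixes F :: "'a::t2_space \<Rightarrow> complex"
  assumes "q \<in> trig" "continuous_on UNIV F"
  shows "\<exists>r\<in>trig. \<forall>(x, w)\<in>cylinder. r (x, w) = F x * w powi n * q (x, w)"
  using assms(1)
proof induction
  case (monomial G m)
  have "(\<lambda>(x, w). (F x * G x) * w powi (n + m)) \<in> trig"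
    by (intro trig.monomial continuous_intros assms monomial)
  then show ?case by (rule rev_bexI) (auto intro!: power_int_add)
next
  case (add p q)
  then obtain r s where rs: "r \<in> trig" "\<forall>(x, w)\<in>cylinder. r (x, w) = F x * w powi n * p (x, w)"
    "s \<in> trig" "\<forall>(x, w)\<in>cylinder. s (x, w) = F x * w powi n * q (x, w)" by blast
  show ?case by (rule bexI[OF _ trig.add[OF rs(1,3)]]) (use rs(2,4) in \<open>auto simp: algebra_simps\<close>)
qed

lemma trig_mult:
  assumes "p \<in> trig" "q \<in> trig"
  shows "\<exists>r\<in>trig. \<forall>z\<in>cylinder. r z = p z * q z"
  using assms(1)
proof induction
  case (monomial F n)
  from trig_mult_monomial[OF assms(2) this, of n] show ?case by auto
next
  case (add p p')
  then obtain r s where rs: "r \<in> trig" "\<forall>z\<in>cylinder. r z = p z * q z"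
    "s \<in> trig" "\<forall>z\<in>cylinder. s z = p' z * q z" by blast
  show ?case by (rule bexI[OF _ trig.add[OF rs(1,3)]]) (use rs(2,4) in \<open>auto simp: algebra_simps\<close>)
qed

lemma trig_const_monomial: "(\<lambda>(x, w). c * w powi n) \<in> trig"
  using trig.monomial[of "\<lambda>_. c" n] by simp

text \<open>Stone--Weierstrass is applied to a ring of real functions, so the real-valued
  polynomials are singled out. They are compared on the cylinder only, which makes the set
  insensitive to values off the circle.\<close>

definition real_trig :: "('a::t2_space \<times> complex \<Rightarrow> real) set" where
  "real_trig = {r. \<exists>p\<in>trig. \<forall>z\<in>cylinder. complex_of_real (r z) = p z}"

lemma real_trigI: "p \<in> trig \<Longrightarrow> (\<And>z. z \<in> cylinder \<Longrightarrow> complex_of_real (r z) = p z) \<Longrightarrow> r \<in> real_trig"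
  by (auto simp: real_trig_def)

lemma real_trigE:
  assumes "r \<in> real_trig"
  obtains p where "p \<in> trig" "\<And>z. z \<in> cylinder \<Longrightarrow> complex_of_real (r z) = p z"
  using assms unfolding real_trig_def by blast

lemma inverse_on_circle: "cmod w = 1 \<Longrightarrow> inverse w = cnj w"
  by (rule inverse_unique) (simp add: complex_norm_square[symmetric])

lemma function_ring_real_trig:
  assumes comp: "compact (UNIV :: 'a::t2_space set)"
  shows "function_ring_on (real_trig :: ('a \<times> complex \<Rightarrow> real) set) cylinder"
proof
  show "compact (cylinder :: ('a \<times> complex) set)" by (intro compact_Times comp compact_sphere)
  show "continuous_on cylinder r" if r: "r \<in> real_trig" for r :: "'a \<times> complex \<Rightarrow> real"
  proof -
    obtain p where p: "p \<in> trig" "\<And>z. z \<in> cylinder \<Longrightarrow> complex_of_real (r z) = p z"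
      using r by (rule real_trigE) (rule that)
    have "continuous_on cylinder (\<lambda>z. Re (p z))" by (intro continuous_intros continuous_trig p)
    moreover have "Re (p z) = r z" if "z \<in> cylinder" for z
      using arg_cong[OF p(2)[OF that], of Re] by simp
    ultimately show ?thesis by (rule continuous_on_eq)
  qed
  show "(\<lambda>z. r z + s z) \<in> real_trig" if r: "r \<in> real_trig" and s: "s \<in> real_trig"
    for r s :: "'a \<times> complex \<Rightarrow> real"
  proof -
    obtain p where p: "p \<in> trig" "\<And>z. z \<in> cylinder \<Longrightarrow> complex_of_real (r z) = p z"
      using r by (rule real_trigE) (rule that)
    obtain q where q: "q \<in> trig" "\<And>z. z \<in> cylinder \<Longrightarrow> complex_of_real (s z) = q z"
      using s by (rule real_trigE) (rule that)
    show ?thesis by (rule real_trigI[OF trig.add[OF p(1) q(1)]]) (simp add: p q)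
  qed
  show "(\<lambda>z. r z * s z) \<in> real_trig" if r: "r \<in> real_trig" and s: "s \<in> real_trig"
    for r s :: "'a \<times> complex \<Rightarrow> real"
  proof -
    obtain p where p: "p \<in> trig" "\<And>z. z \<in> cylinder \<Longrightarrow> complex_of_real (r z) = p z"
      using r by (rule real_trigE) (rule that)
    obtain q where q: "q \<in> trig" "\<And>z. z \<in> cylinder \<Longrightarrow> complex_of_real (s z) = q z"
      using s by (rule real_trigE) (rule that)
    obtain t where t: "t \<in> trig" "\<forall>z\<in>cylinder. t z = p z * q z" using trig_mult[OF p(1) q(1)] by blast
    show ?thesis by (rule real_trigI[OF t(1)]) (simp add: p q t(2)[rule_format])
  qed
  show "(\<lambda>_. c) \<in> (real_trig :: ('a \<times> complex \<Rightarrow> real) set)" for c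
    by (rule real_trigI[OF trig_const_monomial[of "complex_of_real c" 0]]) auto
  show "\<exists>r\<in>real_trig. r y \<noteq> r z" if "y \<in> cylinder" "z \<in> cylinder" "y \<noteq> z" for y z :: "'a \<times> complex"
  proof (cases "fst y = fst z")
    case False
    obtain \<psi> :: "'a \<Rightarrow> real" where \<psi>: "continuous_on UNIV \<psi>" "\<And>x. x \<in> {fst y} \<Longrightarrow> \<psi> x = 0" "\<And>x. x \<in> {fst z} \<Longrightarrow> \<psi> x = 1"
      by (rule compact_t2_Urysohn[OF comp, of "{fst y}" "{fst z}"]) (use False in auto)
    have "(\<lambda>(x, w). complex_of_real (\<psi> x) * w powi 0) \<in> trig"
      by (intro trig.monomial continuous_intros \<psi>(1))
    then have "(\<lambda>z. \<psi> (fst z)) \<in> real_trig" by (rule real_trigI) auto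
    then show ?thesis by (rule rev_bexI) (simp add: \<psi>)
  next
    case True
    \<comment> \<open>Points over the same base point are separated by the real or imaginary part of
      \<open>w\<close>. On the circle the inverse is the conjugate, so both parts are combinations
      of the exponents 1 and -1.\<close>
    have *: "(\<lambda>z. (\<lambda>(x, w). a * w powi 1) z + (\<lambda>(x, w). b * w powi (-1)) z) \<in> (trig :: ('a \<times> complex \<Rightarrow> complex) set)" for a b
      by (intro trig.add trig_const_monomial)
    have re: "(\<lambda>z :: 'a \<times> complex. Re (snd z)) \<in> real_trig"
      by (rule real_trigI[OF *[of "1/2" "1/2"]])
         (auto simp: power_int_minus inverse_on_circle complex_eq_iff)
    have im: "(\<lambda>z :: 'a \<times> complex. Im (snd z)) \<in> real_trig"
      by (rule real_trigI[OF *[of "- \<i>/2" "\<i>/2"]])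
         (auto simp: power_int_minus inverse_on_circle complex_eq_iff)
    have "snd y \<noteq> snd z" using True that(3) by (simp add: prod_eq_iff)
    then have "Re (snd y) \<noteq> Re (snd z) \<or> Im (snd y) \<noteq> Im (snd z)" by (simp add: complex_eq_iff)
    then show ?thesis
    proof
      assume "Re (snd y) \<noteq> Re (snd z)"
      then show ?thesis by (intro bexI[OF _ re])
    next
      assume "Im (snd y) \<noteq> Im (snd z)"
      then show ?thesis by (intro bexI[OF _ im])
    qed
  qed
qed

lemma trig_dense:
  fixes h :: "'a::t2_space \<times> complex \<Rightarrow> complex"
  assumes comp: "compact (UNIV :: 'a set)" and h: "continuous_on cylinder h" and e: "0 < e"
  shows "\<exists>p\<in>trig. \<forall>z\<in>cylinder. cmod (h z - p z) \<le> e"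
proof -
  interpret function_ring_on "real_trig :: ('a \<times> complex \<Rightarrow> real) set" cylinder
    by (rule function_ring_real_trig[OF comp])
  have "continuous_on cylinder (\<lambda>z. Re (h z))" "continuous_on cylinder (\<lambda>z. Im (h z))"
    by (intro continuous_intros h)+
  from this[THEN Stone_Weierstrass_basic, of "e/2"] e
  obtain r s where rs: "r \<in> real_trig" "\<And>z. z \<in> cylinder \<Longrightarrow> \<bar>Re (h z) - r z\<bar> < e/2"
    "s \<in> real_trig" "\<And>z. z \<in> cylinder \<Longrightarrow> \<bar>Im (h z) - s z\<bar> < e/2" by auto
  obtain p where p: "p \<in> trig" "\<And>z. z \<in> cylinder \<Longrightarrow> complex_of_real (r z) = p z"
    using rs(1) by (rule real_trigE) (rule that)
  obtain q where q: "q \<in> trig" "\<And>z. z \<in> cylinder \<Longrightarrow> complex_of_real (s z) = q z"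
    using rs(3) by (rule real_trigE) (rule that)
  \<comment> \<open>Real and imaginary parts are approximated within \<open>e/2\<close> each. The
    factor \<open>\<i>\<close> is attached by multiplying with a constant monomial.\<close>
  obtain t where t: "t \<in> trig" "\<forall>z\<in>cylinder. t z = (\<lambda>(x, w). \<i> * w powi 0) z * q z"
    using trig_mult[OF trig_const_monomial[of \<i> 0] q(1)] by blast
  have close: "cmod (h z - (p z + t z)) \<le> e" if z: "z \<in> cylinder" for z
  proof -
    have pz: "p z = complex_of_real (r z)" by (rule p(2)[OF z, symmetric])
    have tz: "t z = \<i> * complex_of_real (s z)"
      using bspec[OF t(2) z] unfolding q(2)[OF z] by (simp add: case_prod_beta)
    have "cmod (h z - (p z + t z)) \<le> \<bar>Re (h z) - r z\<bar> + \<bar>Im (h z) - s z\<bar>"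
      using cmod_le[of "h z - (p z + t z)"] unfolding pz tz by simp
    also have "\<dots> \<le> e" using rs(2)[OF z] rs(4)[OF z] by linarith
    finally show ?thesis .
  qed
  show ?thesis by (intro bexI[OF _ trig.add[OF p(1) t(1)]] ballI close)
qed

section \<open>Reduction of the skew product to weighted averages\<close>

locale skew_product = uniquely_ergodic_system \<theta> \<theta>' \<mu>
  for \<theta> \<theta>' :: "'a::t2_space \<Rightarrow> 'a" and \<mu> +
  fixes f :: "'a \<Rightarrow> complex"
  assumes continuous_f: "continuous_on UNIV f"
    and norm_f: "cmod (f x) = 1"
begin

lemma weighted: "weighted_system \<theta> \<theta>' \<mu> (\<lambda>x. f x powi n)"
proof unfold_locales
  have "f x \<noteq> 0" for x using norm_f[of x] by auto
  then show "continuous_on UNIV (\<lambda>x. f x powi n)" by (intro continuous_on_power_int continuous_f) auto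
qed (simp add: norm_power_int norm_f)

lemma cocycle_powi: "cocycle \<theta> (\<lambda>x. f x powi n) k x = cocycle \<theta> f k x powi n"
  by (induction k) (simp_all add: cocycle_def power_int_mult_distrib)

lemma iterate_skew: "(skew \<theta> f ^^ k) (x, w) = ((\<theta> ^^ k) x, cocycle \<theta> f k x * w)"
  by (induction k) (simp_all add: skew_def cocycle_def)

lemma skew_cylinder: "z \<in> cylinder \<Longrightarrow> skew \<theta> f z \<in> cylinder"
  by (auto simp: skew_def norm_mult norm_f)

text \<open>Along the orbit the circle coordinate is the cocycle of \<open>f\<close> times
  \<open>w\<close>; its \<open>n\<close>-th power separates into the cocycle of
  \<open>f powi n\<close> and \<open>w powi n\<close>. Each Fourier mode is therefore preserved and
  sees its own weight.\<close>

lemma orbit_average_monomial: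
  "orbit_average (skew \<theta> f) N (\<lambda>(x, w). F x * w powi n) (x, w) = cesaro \<theta> (\<lambda>x. f x powi n) N F x * w powi n"
  by (simp add: orbit_average_def cesaro_def wpow_def iterate_skew cocycle_powi power_int_mult_distrib
      sum_distrib_left sum_distrib_right mult_ac)

lemma continuous_orbit_average:
  assumes "continuous_on cylinder h"
  shows "continuous_on cylinder (orbit_average (skew \<theta> f) N h)"
proof -
  have "continuous_on UNIV (skew \<theta> f)"
    unfolding skew_def case_prod_beta
    by (intro continuous_intros continuous_on_compose2[OF continuous_theta] continuous_on_compose2[OF continuous_f]) auto
  then have "continuous_on cylinder (skew \<theta> f)" by (rule continuous_on_subset) simp
  have it: "continuous_on cylinder (skew \<theta> f ^^ k) \<and> (skew \<theta> f ^^ k) ` cylinder \<subseteq> cylinder" for k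
  proof (induction k)
    case (Suc k)
    then show ?case using continuous_on_compose2[OF \<open>continuous_on cylinder (skew \<theta> f)\<close>, of cylinder "skew \<theta> f ^^ k"]
        skew_cylinder by (auto simp: comp_def image_subset_iff)
  qed (simp add: id_def)
  show ?thesis
    unfolding orbit_average_def[abs_def] divide_inverse
    by (intro continuous_intros continuous_on_compose2[OF assms]) (use it in auto)
qed

text \<open>Restricting a monomial to the slice \<open>w = 1\<close> recovers the weighted average.
  Conversely \<open>w powi n\<close> has modulus 1 on the circle, so uniform convergence lifts to
  monomials, then to sums, and by density to all continuous functions.\<close>

lemma uniquely_ergodic_fixed_iff:
  "uniquely_ergodic_fixed cylinder (skew \<theta> f) \<longleftrightarrow>
    (\<forall>n F. continuous_on UNIV F \<longrightarrow>
      (\<exists>G. continuous_on UNIV G \<and> uniform_limit UNIV (\<lambda>N. cesaro \<theta> (\<lambda>x. f x powi n) N F) G sequentially))"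
  (is "?L \<longleftrightarrow> ?R")
proof
  assume L: ?L
  show ?R
  proof (intro allI impI)
    fix n and F :: "'a \<Rightarrow> complex" assume F: "continuous_on UNIV F"
    from L continuous_monomial[OF F, of n] obtain l where cl: "continuous_on cylinder l"
      and l: "uniform_limit cylinder (\<lambda>N. orbit_average (skew \<theta> f) N (\<lambda>(x, w). F x * w powi n)) l sequentially"
      unfolding uniquely_ergodic_fixed_def orbit_average_def by blast
    have "continuous_on UNIV (\<lambda>x. l (x, 1))"
      by (rule continuous_on_compose2[OF cl]) (auto intro!: continuous_intros)
    moreover have "uniform_limit UNIV (\<lambda>N. cesaro \<theta> (\<lambda>x. f x powi n) N F) (\<lambda>x. l (x, 1)) sequentially"
    proof (rule uniform_limitI)
      fix e :: real assume "0 < e"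
      from uniform_limitD[OF l this]
      show "\<forall>\<^sub>F N in sequentially. \<forall>x\<in>UNIV. dist (cesaro \<theta> (\<lambda>x. f x powi n) N F x) (l (x, 1)) < e"
      proof eventually_elim
        case (elim N)
        show ?case
        proof
          fix x
          from bspec[OF elim, of "(x, 1)"] show "dist (cesaro \<theta> (\<lambda>x. f x powi n) N F x) (l (x, 1)) < e"
            by (simp add: orbit_average_monomial)
        qed
      qed
    qed
    ultimately show "\<exists>G. continuous_on UNIV G \<and>
        uniform_limit UNIV (\<lambda>N. cesaro \<theta> (\<lambda>x. f x powi n) N F) G sequentially" by blast
  qed
next
  assume R: ?R
  have trig: "uniformly_convergent_on cylinder (\<lambda>N. orbit_average (skew \<theta> f) N p)" if "p \<in> trig" for p
    using that
  proof induction
    case (monomial F n)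
    with R obtain G where G: "uniform_limit UNIV (\<lambda>N. cesaro \<theta> (\<lambda>x. f x powi n) N F) G sequentially" by blast
    have "uniform_limit cylinder (\<lambda>N. orbit_average (skew \<theta> f) N (\<lambda>(x, w). F x * w powi n))
        (\<lambda>(x, w). G x * w powi n) sequentially"
    proof (rule uniform_limitI)
      fix e :: real assume "0 < e"
      from uniform_limitD[OF G this]
      show "\<forall>\<^sub>F N in sequentially. \<forall>z\<in>cylinder.
          dist (orbit_average (skew \<theta> f) N (\<lambda>(x, w). F x * w powi n) z) ((\<lambda>(x, w). G x * w powi n) z) < e"
      proof eventually_elim
        case (elim N)
        show ?case
        proof
          fix z :: "'a \<times> complex" assume "z \<in> cylinder"
          then obtain x w where z: "z = (x, w)" "cmod w = 1" by auto
          have "dist (cesaro \<theta> (\<lambda>x. f x powi n) N F x) (G x) < e" using elim by simp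
          then show "dist (orbit_average (skew \<theta> f) N (\<lambda>(x, w). F x * w powi n) z) ((\<lambda>(x, w). G x * w powi n) z) < e"
            using z(2) unfolding z(1) orbit_average_monomial
            by (simp add: dist_norm norm_mult norm_power_int flip: left_diff_distrib)
        qed
      qed
    qed
    then show ?case unfolding uniformly_convergent_on_def by blast
  next
    case (add p q)
    then obtain l l' where "uniform_limit cylinder (\<lambda>N. orbit_average (skew \<theta> f) N p) l sequentially"
      "uniform_limit cylinder (\<lambda>N. orbit_average (skew \<theta> f) N q) l' sequentially"
      unfolding uniformly_convergent_on_def by blast
    from uniform_limit_add[OF this] show ?case
      unfolding orbit_average_add by (rule uniformly_convergentI)
  qed
  show ?L
    unfolding uniquely_ergodic_fixed_def
  proof (intro allI impI)
    fix h :: "'a \<times> complex \<Rightarrow> complex" assume h: "continuous_on cylinder h"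
    have "uniformly_convergent_on cylinder (\<lambda>N. orbit_average (skew \<theta> f) N h)"
    proof (rule uniformly_convergent_orbit_average_approx[OF skew_cylinder])
      fix e :: real assume "0 < e"
      from trig_dense[OF compact_UNIV h this] trig
      show "\<exists>p. (\<forall>z\<in>cylinder. cmod (h z - p z) \<le> e) \<and>
          uniformly_convergent_on cylinder (\<lambda>N. orbit_average (skew \<theta> f) N p)" by blast
    qed
    then obtain l where l: "uniform_limit cylinder (\<lambda>N. orbit_average (skew \<theta> f) N h) l sequentially"
      unfolding uniformly_convergent_on_def by blast
    moreover have "continuous_on cylinder l"
      by (rule uniform_limit_theorem[OF _ l]) (auto intro!: always_eventually continuous_orbit_average[OF h])
    ultimately show "\<exists>L. continuous_on cylinder L \<and>
        uniform_limit cylinder (\<lambda>n p. (\<Sum>k<n. h ((skew \<theta> f ^^ k) p)) / of_nat n) L sequentially"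
      unfolding orbit_average_def by blast
  qed
qed

end

theorem mainTheorem17:
  fixes \<theta> :: "'a::t2_space \<Rightarrow> 'a" and \<theta>' :: "'a \<Rightarrow> 'a"
    and f :: "'a \<Rightarrow> complex" and \<mu> :: "'a measure"
  assumes "compact (UNIV :: 'a set)"
    and "homeomorphism UNIV UNIV \<theta> \<theta>'"
    and "uniquely_ergodic_top \<theta>"
    and "regular_borel_prob \<mu>" and "invariant_measure \<theta> \<mu>"
    and "continuous_on UNIV f" and "\<forall>x. cmod (f x) = 1"
  shows "uniquely_ergodic_fixed (UNIV \<times> sphere 0 1) (skew \<theta> f) \<longleftrightarrow>
    (\<forall>n::int. \<forall>g :: 'a \<Rightarrow> complex.
       (g \<in> borel_measurable \<mu> \<and> (\<exists>C. AE x in \<mu>. cmod (g x) \<le> C) \<and>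
        (AE x in \<mu>. g (\<theta> x) * f x powi n = g x))
       \<longrightarrow> (\<exists>G. continuous_on UNIV G \<and> (\<forall>x. G (\<theta> x) * f x powi n = G x) \<and>
               (AE x in \<mu>. g x = G x)))"
proof -
  interpret skew_product \<theta> \<theta>' \<mu> f
    by unfold_locales (use assms in auto)
  \<comment> \<open>After the reduction both implications are proved one exponent at a time, each
    \<open>n\<close> giving its own instance of \<open>weighted_system\<close>.\<close>
  show ?thesis
    unfolding uniquely_ergodic_fixed_iff
  proof (intro iffI allI impI)
    fix n :: int and g :: "'a \<Rightarrow> complex"
    assume conv: "\<forall>n F. continuous_on UNIV F \<longrightarrow>
        (\<exists>G. continuous_on UNIV G \<and> uniform_limit UNIV (\<lambda>N. cesaro \<theta> (\<lambda>x. f x powi n) N F) G sequentially)"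
      and g: "g \<in> borel_measurable \<mu> \<and> (\<exists>C. AE x in \<mu>. cmod (g x) \<le> C) \<and> (AE x in \<mu>. g (\<theta> x) * f x powi n = g x)"
    interpret weighted_system \<theta> \<theta>' \<mu> "\<lambda>x. f x powi n" by (rule weighted)
    from g obtain C where "AE x in \<mu>. cmod (g x) \<le> C" by blast
    then show "\<exists>G. continuous_on UNIV G \<and> (\<forall>x. G (\<theta> x) * f x powi n = G x) \<and> (AE x in \<mu>. g x = G x)"
      using conv g by (intro fixed_continuous_if_uniform_limit) auto
  next
    fix n :: int and F :: "'a \<Rightarrow> complex"
    assume fixed: "\<forall>n::int. \<forall>g. g \<in> borel_measurable \<mu> \<and> (\<exists>C. AE x in \<mu>. cmod (g x) \<le> C) \<and>
          (AE x in \<mu>. g (\<theta> x) * f x powi n = g x) \<longrightarrow>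
          (\<exists>G. continuous_on UNIV G \<and> (\<forall>x. G (\<theta> x) * f x powi n = G x) \<and> (AE x in \<mu>. g x = G x))"
      and F: "continuous_on UNIV F"
    interpret weighted_system \<theta> \<theta>' \<mu> "\<lambda>x. f x powi n" by (rule weighted)
    obtain G where "continuous_on UNIV G" "uniform_limit UNIV (\<lambda>N. cesaro \<theta> (\<lambda>x. f x powi n) N F) G sequentially"
      by (rule uniform_limit_if_fixed_continuous[OF _ F]) (use fixed in blast)
    then show "\<exists>G. continuous_on UNIV G \<and> uniform_limit UNIV (\<lambda>N. cesaro \<theta> (\<lambda>x. f x powi n) N F) G sequentially"
      by blast
  qed
qed

end
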